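(* Let $(W,S)$ be a Coxeter system and suppose $W$ is a subgroup of the fundamental group $\pi_1(\Lambda)$ of a graph of groups $\Lambda$. Then $W$ has a visual graph of groups decomposition $\Psi$ (with respect to $S$) such that each vertex group of $\Psi$ is a subgroup of a conjugate (in $\pi_1(\Lambda)$) of a vertex group of $\Lambda$, and each edge group of $\Psi$ is a subgroup of a conjugate of an edge group of $\Lambda$. Moreover, $\Psi$ can be taken so that each special subgroup of $W$ that is a subgroup of a conjugate of a vertex group of $\Lambda$ is a subgroup of a vertex group of $\Psi$.
   Context: A Coxeter presentation is $\langle S : (st)^{m(s,t)}\ (s,t\in S,\ m(s,t)<\infty)\rangle$ where $m:S^2\to\{1,2,\ldots,\infty\}$, $m(s,t)=m(t,s)$, and $m(s,t)=1$ iff $s=t$. A Coxeter system $(W,S)$ is a group $W$ with a generating set $S$ corresponding to the generators of a Coxeter presentation of $W$. A special subgroup of $(W,S)$ is a subgroup $\langle A\rangle$ generated by a subset $A\subseteq S$. Graphs of groups are in the usual (Bass–Serre) sense: a connected graph with vertex groups $\Lambda(V)$, edge groups $\Lambda(E)\subset\Lambda(\iota(E))$, and injective edge maps $\Lambda(E)\to\Lambda(\tau(E))$. Graphs may be infinite. The vertex and edge groups of $\Lambda$ are identified with the corresponding subgroups of $\pi_1(\Lambda)$. A visual graph of groups decomposition of $W$ (with respect to $S$) is a graph of groups $\Psi$ in which each vertex group and edge group is a special subgroup of $(W,S)$, the injection of each edge group into each of its endpoint vertex groups is inclusion, and the homomorphism $\pi_1(\Psi)\to W$ induced by the inclusions of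 the vertex groups into $W$ is an isomorphism. (The underlying graph of $\Psi$ is then necessarily a tree.) *)

theory Defs
  imports
    "HOL-Algebra.Coset"
    "HOL-Algebra.Generated_Groups"
    "HOL-Library.Extended_Nat"
    "Graph_Theory.Digraph_Component"
begin

section \<open>Groups given by generators and relators\<close>

text \<open>A letter \<open>(x, True)\<close> stands for the generator \<open>x\<close>, and \<open>(x, False)\<close> for its formal inverse.\<close>

type_synonym 'g word = "('g \<times> bool) list"

definition words :: "'g set \<Rightarrow> 'g word set" where
  "words X = lists (X \<times> UNIV)"

inductive pres_eq :: "'g set \<Rightarrow> 'g word set \<Rightarrow> 'g word \<Rightarrow> 'g word \<Rightarrow> bool"
  for X :: "'g set" and R :: "'g word set"
where
  refl: "w \<in> words X \<Longrightarrow> pres_eq X R w w"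
| sym: "pres_eq X R v w \<Longrightarrow> pres_eq X R w v"
| trans: "pres_eq X R u v \<Longrightarrow> pres_eq X R v w \<Longrightarrow> pres_eq X R u w"
| cancel: "u \<in> words X \<Longrightarrow> v \<in> words X \<Longrightarrow> x \<in> X \<Longrightarrow>
    pres_eq X R (u @ [(x, b), (x, \<not> b)] @ v) (u @ v)"
| relator: "u \<in> words X \<Longrightarrow> v \<in> words X \<Longrightarrow> r \<in> R \<Longrightarrow> r \<in> words X \<Longrightarrow>
    pres_eq X R (u @ r @ v) (u @ v)"

definition pres_class :: "'g set \<Rightarrow> 'g word set \<Rightarrow> 'g word \<Rightarrow> 'g word set" where
  "pres_class X R w = {v. pres_eq X R w v}"

definition presented_group :: "'g set \<Rightarrow> 'g word set \<Rightarrow> 'g word set monoid" where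
  "presented_group X R =
    \<lparr>carrier = pres_class X R ` words X,
     monoid.mult = (\<lambda>A B. \<Union>a\<in>A. \<Union>b\<in>B. pres_class X R (a @ b)),
     one = pres_class X R []\<rparr>"

lemma pres_eq_words: "pres_eq X R v w \<Longrightarrow> v \<in> words X \<and> w \<in> words X"
  by (induction rule: pres_eq.induct) (auto simp: words_def)

lemma pres_class_eqI: "pres_eq X R v w \<Longrightarrow> pres_class X R v = pres_class X R w"
  unfolding pres_class_def using pres_eq.trans[OF pres_eq.sym, of X R v w] pres_eq.trans[of X R v w]
  by blast

lemma pres_eq_append_left: "pres_eq X R v w \<Longrightarrow> u \<in> words X \<Longrightarrow> pres_eq X R (u @ v) (u @ w)"
proof (induction rule: pres_eq.induct)
  case (refl w)
  then show ?case by (auto intro!: pres_eq.refl simp: words_def)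
next
  case (sym v w)
  show ?case by (rule pres_eq.sym[OF sym.IH[OF sym.prems]])
next
  case (trans u' v w)
  show ?case by (rule pres_eq.trans[OF trans.IH(1)[OF trans.prems] trans.IH(2)[OF trans.prems]])
next
  case (cancel u' v x b)
  then show ?case using pres_eq.cancel[of "u @ u'" X v x R b] by (simp add: words_def)
next
  case (relator u' v r)
  then show ?case using pres_eq.relator[of "u @ u'" X v r R] by (simp add: words_def)
qed

lemma pres_eq_append_right: "pres_eq X R v w \<Longrightarrow> u \<in> words X \<Longrightarrow> pres_eq X R (v @ u) (w @ u)"
proof (induction rule: pres_eq.induct)
  case (refl w)
  then show ?case by (auto intro!: pres_eq.refl simp: words_def)
next
  case (sym v w)
  show ?case by (rule pres_eq.sym[OF sym.IH[OF sym.prems]])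
next
  case (trans u' v w)
  show ?case by (rule pres_eq.trans[OF trans.IH(1)[OF trans.prems] trans.IH(2)[OF trans.prems]])
next
  case (cancel u' v x b)
  then show ?case using pres_eq.cancel[of u' X "v @ u" x R b] by (simp add: words_def)
next
  case (relator u' v r)
  then show ?case using pres_eq.relator[of u' X "v @ u" r R] by (simp add: words_def)
qed

lemma presented_group_mult:
  assumes "v \<in> words X" "w \<in> words X"
  shows "pres_class X R v \<otimes>\<^bsub>presented_group X R\<^esub> pres_class X R w = pres_class X R (v @ w)"
proof -
  have "pres_class X R (a @ b) = pres_class X R (v @ w)"
    if "pres_eq X R v a" "pres_eq X R w b" for a b
  proof -
    have "pres_eq X R (v @ w) (a @ w)"
      by (rule pres_eq_append_right[OF that(1) assms(2)])
    moreover have "pres_eq X R (a @ w) (a @ b)"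
      using pres_eq_append_left[OF that(2)] pres_eq_words[OF that(1)] by blast
    ultimately have "pres_eq X R (v @ w) (a @ b)"
      by (rule pres_eq.trans)
    then show ?thesis
      by (rule pres_class_eqI[symmetric])
  qed
  then have "(\<Union>a\<in>pres_class X R v. \<Union>b\<in>pres_class X R w. pres_class X R (a @ b)) =
      (\<Union>a\<in>pres_class X R v. \<Union>b\<in>pres_class X R w. pres_class X R (v @ w))"
    unfolding pres_class_def mem_Collect_eq by (intro SUP_cong) auto
  moreover have "v \<in> pres_class X R v" "w \<in> pres_class X R w"
    using assms by (auto simp: pres_class_def intro: pres_eq.refl)
  ultimately show ?thesis
    by (auto simp: presented_group_def)
qed

lemma pres_left_inverse:
  assumes "w \<in> words X"
  shows "pres_eq X R (rev (map (\<lambda>(x, b). (x, \<not> b)) w) @ w) []"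
  using assms
proof (induction w)
  case Nil
  then show ?case by (auto intro: pres_eq.refl simp: words_def)
next
  case (Cons l w)
  obtain x b where l: "l = (x, b)" by (cases l)
  let ?i = "rev (map (\<lambda>(x, b). (x, \<not> b)) w)"
  have w: "w \<in> words X" "?i \<in> words X" "x \<in> X"
    using Cons.prems l by (auto simp: words_def)
  have "pres_eq X R (?i @ [(x, \<not> b), (x, b)] @ w) (?i @ w)"
    using pres_eq.cancel[OF w(2) w(1) w(3), of R "\<not> b"] by simp
  then show ?case using pres_eq.trans[OF _ Cons.IH[OF w(1)]] l by simp
qed

lemma group_presented_group: "group (presented_group X R)"
proof (rule groupI)
  let ?G = "presented_group X R"
  have car: "carrier ?G = pres_class X R ` words X" and one: "\<one>\<^bsub>?G\<^esub> = pres_class X R []"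
    by (simp_all add: presented_group_def)
  have nil: "[] \<in> words X" by (simp add: words_def)
  have app: "v @ w \<in> words X" if "v \<in> words X" "w \<in> words X" for v w
    using that by (simp add: words_def)
  show "\<one>\<^bsub>?G\<^esub> \<in> carrier ?G" using nil by (simp add: car one)
  fix x assume "x \<in> carrier ?G"
  then obtain u where u: "u \<in> words X" "x = pres_class X R u" by (auto simp: car)
  show "\<one>\<^bsub>?G\<^esub> \<otimes>\<^bsub>?G\<^esub> x = x"
    using u nil by (simp add: one presented_group_mult)
  let ?i = "rev (map (\<lambda>(x, b). (x, \<not> b)) u)"
  have i: "?i \<in> words X" using u(1) by (auto simp: words_def)
  have "pres_class X R ?i \<otimes>\<^bsub>?G\<^esub> x = \<one>\<^bsub>?G\<^esub>"
    using u i pres_class_eqI[OF pres_left_inverse[OF u(1)]]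
    by (simp add: one presented_group_mult)
  then show "\<exists>y\<in>carrier ?G. y \<otimes>\<^bsub>?G\<^esub> x = \<one>\<^bsub>?G\<^esub>"
    using i by (auto simp: car)
  fix y assume "y \<in> carrier ?G"
  then obtain v where v: "v \<in> words X" "y = pres_class X R v" by (auto simp: car)
  show "x \<otimes>\<^bsub>?G\<^esub> y \<in> carrier ?G"
    using u v app[OF u(1) v(1)] by (auto simp: car presented_group_mult)
  fix z assume "z \<in> carrier ?G"
  then obtain w where w: "w \<in> words X" "z = pres_class X R w" by (auto simp: car)
  show "x \<otimes>\<^bsub>?G\<^esub> y \<otimes>\<^bsub>?G\<^esub> z = x \<otimes>\<^bsub>?G\<^esub> (y \<otimes>\<^bsub>?G\<^esub> z)"
    using u v w app by (simp add: presented_group_mult)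
qed


section \<open>Coxeter systems\<close>

definition coxeter_matrix :: "'g set \<Rightarrow> ('g \<Rightarrow> 'g \<Rightarrow> enat) \<Rightarrow> bool" where
  "coxeter_matrix S m \<longleftrightarrow>
    (\<forall>s\<in>S. \<forall>t\<in>S. 1 \<le> m s t \<and> m s t = m t s \<and> (m s t = 1 \<longleftrightarrow> s = t))"

definition coxeter_relators :: "'g set \<Rightarrow> ('g \<Rightarrow> 'g \<Rightarrow> enat) \<Rightarrow> 'g word set" where
  "coxeter_relators S m =
    {concat (replicate k [(s, True), (t, True)]) | s t k. s \<in> S \<and> t \<in> S \<and> m s t = enat k}"

text \<open>No finiteness of \<open>S\<close> is assumed.\<close>

definition coxeter_system :: "'a monoid \<Rightarrow> 'a set \<Rightarrow> bool" where
  "coxeter_system W S \<longleftrightarrow> group W \<and> S \<subseteq> carrier W \<and>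
    (\<exists>m. coxeter_matrix S m \<and>
      (\<exists>h \<in> iso (presented_group S (coxeter_relators S m)) W.
        \<forall>s\<in>S. h (pres_class S (coxeter_relators S m) [(s, True)]) = s))"

definition special_subgroup :: "'a monoid \<Rightarrow> 'a set \<Rightarrow> 'a set \<Rightarrow> bool" where
  "special_subgroup W S H \<longleftrightarrow> (\<exists>A\<subseteq>S. H = generate W A)"


section \<open>Trees\<close>

text \<open>
  Edges of a graph of groups are oriented, but cycles may traverse them in either direction.
  The library predicates \<open>forest\<close>, \<open>tree\<close> and \<open>spanning_tree\<close> only exclude \<^emph>\<open>directed\<close> cycles, so
  they are not used here (\<open>connected\<close> does ignore orientations). Instead a cycle is taken in the
  digraph that contains each arc in both orientations, and may use no edge twice.
\<close>

definition both_orientations :: "('v, 'e) pre_digraph \<Rightarrow> ('v, 'e \<times> bool) pre_digraph" where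
  "both_orientations G =
    \<lparr>verts = verts G, arcs = arcs G \<times> UNIV,
     tail = (\<lambda>(e, b). if b then tail G e else head G e),
     head = (\<lambda>(e, b). if b then head G e else tail G e)\<rparr>"

definition unoriented_tree :: "('v, 'e) pre_digraph \<Rightarrow> bool" where
  "unoriented_tree G \<longleftrightarrow> Digraph_Component.connected G \<and>
    \<not> (\<exists>p. pre_digraph.cycle (both_orientations G) p \<and> distinct (map fst p))"

definition unoriented_spanning_tree :: "('v, 'e) pre_digraph \<Rightarrow> ('v, 'e) pre_digraph \<Rightarrow> bool" where
  "unoriented_spanning_tree T G \<longleftrightarrow> spanning T G \<and> unoriented_tree T"


section \<open>Graphs of groups\<close>

record ('v, 'e, 'a) graph_of_groups =
  gog_graph :: "('v, 'e) pre_digraph"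
  vertex_group :: "'v \<Rightarrow> 'a monoid"
  edge_group :: "'e \<Rightarrow> 'a set"
  edge_map :: "'e \<Rightarrow> 'a \<Rightarrow> 'a"

definition is_graph_of_groups :: "('v, 'e, 'a) graph_of_groups \<Rightarrow> bool" where
  "is_graph_of_groups \<Lambda> \<longleftrightarrow>
    wf_digraph (gog_graph \<Lambda>) \<and> Digraph_Component.connected (gog_graph \<Lambda>) \<and>
    (\<forall>v \<in> verts (gog_graph \<Lambda>). group (vertex_group \<Lambda> v)) \<and>
    (\<forall>e \<in> arcs (gog_graph \<Lambda>).
      subgroup (edge_group \<Lambda> e) (vertex_group \<Lambda> (tail (gog_graph \<Lambda>) e)) \<and>
      edge_map \<Lambda> e \<in> mon ((vertex_group \<Lambda> (tail (gog_graph \<Lambda>) e))\<lparr>carrier := edge_group \<Lambda> e\<rparr>)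
        (vertex_group \<Lambda> (head (gog_graph \<Lambda>) e)))"

datatype ('v, 'e, 'a) gog_gen = VGen 'v 'a | Stable 'e

definition gog_gens :: "('v, 'e, 'a) graph_of_groups \<Rightarrow> ('v, 'e, 'a) gog_gen set" where
  "gog_gens \<Lambda> =
    {VGen v g | v g. v \<in> verts (gog_graph \<Lambda>) \<and> g \<in> carrier (vertex_group \<Lambda> v)} \<union>
    Stable ` arcs (gog_graph \<Lambda>)"

text \<open>
  The relators say that each vertex group keeps its multiplication table, that
  \<open>g t\<^sub>e = t\<^sub>e f\<^sub>e(g)\<close> for \<open>g\<close> in the edge group of \<open>e\<close> with edge map \<open>f\<^sub>e\<close>, and that \<open>t\<^sub>e = 1\<close> for \<open>e\<close> in
  the spanning tree \<open>T\<close>.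
\<close>

definition gog_relators ::
  "('v, 'e, 'a) graph_of_groups \<Rightarrow> ('v, 'e) pre_digraph \<Rightarrow> ('v, 'e, 'a) gog_gen word set"
where
  "gog_relators \<Lambda> T =
    {[(VGen v g, True), (VGen v h, True), (VGen v (g \<otimes>\<^bsub>vertex_group \<Lambda> v\<^esub> h), False)] | v g h.
      v \<in> verts (gog_graph \<Lambda>) \<and> g \<in> carrier (vertex_group \<Lambda> v) \<and> h \<in> carrier (vertex_group \<Lambda> v)} \<union>
    {[(VGen (tail (gog_graph \<Lambda>) e) g, True), (Stable e, True),
      (VGen (head (gog_graph \<Lambda>) e) (edge_map \<Lambda> e g), False), (Stable e, False)] | e g.
      e \<in> arcs (gog_graph \<Lambda>) \<and> g \<in> edge_group \<Lambda> e} \<union>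
    {[(Stable e, True)] | e. e \<in> arcs T}"

type_synonym ('v, 'e, 'a) pi1_elt = "('v, 'e, 'a) gog_gen word set"

definition pi1 ::
  "('v, 'e, 'a) graph_of_groups \<Rightarrow> ('v, 'e) pre_digraph \<Rightarrow> ('v, 'e, 'a) pi1_elt monoid"
where
  "pi1 \<Lambda> T = presented_group (gog_gens \<Lambda>) (gog_relators \<Lambda> T)"

definition pi1_vertex ::
  "('v, 'e, 'a) graph_of_groups \<Rightarrow> ('v, 'e) pre_digraph \<Rightarrow> 'v \<Rightarrow> 'a \<Rightarrow> ('v, 'e, 'a) pi1_elt"
where
  "pi1_vertex \<Lambda> T v g = pres_class (gog_gens \<Lambda>) (gog_relators \<Lambda> T) [(VGen v g, True)]"

definition pi1_stable ::
  "('v, 'e, 'a) graph_of_groups \<Rightarrow> ('v, 'e) pre_digraph \<Rightarrow> 'e \<Rightarrow> ('v, 'e, 'a) pi1_elt"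
where
  "pi1_stable \<Lambda> T e = pres_class (gog_gens \<Lambda>) (gog_relators \<Lambda> T) [(Stable e, True)]"

definition vertex_subgroup ::
  "('v, 'e, 'a) graph_of_groups \<Rightarrow> ('v, 'e) pre_digraph \<Rightarrow> 'v \<Rightarrow> ('v, 'e, 'a) pi1_elt set"
where
  "vertex_subgroup \<Lambda> T v = pi1_vertex \<Lambda> T v ` carrier (vertex_group \<Lambda> v)"

definition edge_subgroup ::
  "('v, 'e, 'a) graph_of_groups \<Rightarrow> ('v, 'e) pre_digraph \<Rightarrow> 'e \<Rightarrow> ('v, 'e, 'a) pi1_elt set"
where
  "edge_subgroup \<Lambda> T e = pi1_vertex \<Lambda> T (tail (gog_graph \<Lambda>) e) ` edge_group \<Lambda> e"

definition subconjugate :: "('a, 'b) monoid_scheme \<Rightarrow> 'a set \<Rightarrow> 'a set \<Rightarrow> bool" where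
  "subconjugate G H K \<longleftrightarrow> (\<exists>g \<in> carrier G. H \<subseteq> (g <#\<^bsub>G\<^esub> K) #>\<^bsub>G\<^esub> inv\<^bsub>G\<^esub> g)"


section \<open>Visual decompositions\<close>

text \<open>
  The homomorphism induced by the inclusions of the vertex groups is the one that sends the
  stable letters to \<open>1\<close>; this makes sense because all edge maps are inclusions. As it kills every
  stable letter, it can be injective only if every edge lies in \<open>T\<close>.
\<close>

definition visual_decomposition ::
  "'a monoid \<Rightarrow> 'a set \<Rightarrow> ('v, 'e, 'a) graph_of_groups \<Rightarrow> bool"
where
  "visual_decomposition W S \<Psi> \<longleftrightarrow>
    is_graph_of_groups \<Psi> \<and>
    (\<forall>v \<in> verts (gog_graph \<Psi>).
      \<exists>H. special_subgroup W S H \<and> vertex_group \<Psi> v = W\<lparr>carrier := H\<rparr>) \<and>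
    (\<forall>e \<in> arcs (gog_graph \<Psi>).
      special_subgroup W S (edge_group \<Psi> e) \<and> (\<forall>x \<in> edge_group \<Psi> e. edge_map \<Psi> e x = x)) \<and>
    (\<exists>T. unoriented_spanning_tree T (gog_graph \<Psi>) \<and>
      (\<exists>h \<in> iso (pi1 \<Psi> T) W.
        (\<forall>v \<in> verts (gog_graph \<Psi>). \<forall>g \<in> carrier (vertex_group \<Psi> v). h (pi1_vertex \<Psi> T v g) = g) \<and>
        (\<forall>e \<in> arcs (gog_graph \<Psi>). h (pi1_stable \<Psi> T e) = \<one>\<^bsub>W\<^esub>)))"

end

theory Submission
  imports Defs
begin

text \<open>
  Let \<open>\<pi>\<close> act on the Bass--Serre tree of \<open>\<Lambda>\<close>. Every generator and every dihedral subgroup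
  \<open>\<langle>s, t\<rangle>\<close> with \<open>m(s, t) < \<infinity>\<close> fixes a vertex, and the subgraph fixed by a generator is a tree. So the
  Bass--Serre tree itself, with the special subgroup \<open>\<langle>{s \<in> S. s x = x}\<rangle>\<close> attached to each vertex and
  edge \<open>x\<close>, is a graph of groups whose fundamental group has the Coxeter presentation of \<open>W\<close>: the copies
  of \<open>s\<close> in the vertex groups are identified along the fixed tree of \<open>s\<close>, and each relation \<open>(st)\<^sup>m\<close>
  holds in some vertex group.

  That the coset graph is a tree is shown without normal forms. A connected graph is a tree iff it has a
  potential: a map \<open>P\<close> from vertices to sets of edges such that the ends of each edge \<open>e\<close> have
  potentials whose symmetric difference is \<open>{e}\<close>. The edges separating \<open>x\<close> from \<open>y\<close> are then those in
  \<open>P x \<triangle> P y\<close>, and arguments about paths become arguments about these sets.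
\<close>

section \<open>Connected graphs with a potential\<close>

text \<open>The tree property of the Bass--Serre graph is needed three times: for fixed vertices of
  elements of finite order, for connectedness of fixed subgraphs, and for the graph to be its own
  spanning tree, which makes every stable letter of the new fundamental group trivial. Counting
  edges modulo 2 turns this property into algebra: backtracking cancels, orientations do not matter,
  and translations act additively on sets of edges, so that a potential can be produced by a
  homomorphism out of a presented group. A relation \<open>(st)^m = 1\<close> yields a common fixed
  vertex by two minimality arguments: \<open>st\<close> has a fixed vertex because it is periodic,
  and among its fixed vertices one moved least by \<open>s\<close> is not moved at all, since
  \<open>s\<close> and \<open>t\<close> move it to the same place. The attached groups are generated
  by elements of \<open>S\<close> and may be smaller than the stabilizers in \<open>W\<close>, which
  need not be special. No quotient by \<open>W\<close> is formed, so the decomposition may be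
  infinite even when \<Lambda> is finite.\<close>

definition symdiff :: "'a set \<Rightarrow> 'a set \<Rightarrow> 'a set" (infixl "\<triangle>" 65) where
  "A \<triangle> B = {x. (x \<in> A) \<noteq> (x \<in> B)}"

lemma in_symdiff_iff [simp]: "x \<in> A \<triangle> B \<longleftrightarrow> (x \<in> A) \<noteq> (x \<in> B)"
  by (simp add: symdiff_def)

lemma symdiff_assoc: "(A \<triangle> B) \<triangle> C = A \<triangle> (B \<triangle> C)"
  by auto

lemma symdiff_commute: "A \<triangle> B = B \<triangle> A"
  by auto

lemma symdiff_left_commute: "A \<triangle> (B \<triangle> C) = B \<triangle> (A \<triangle> C)"
  by auto

lemma symdiff_self [simp]: "A \<triangle> A = {}"
  by auto

lemma symdiff_left_cancel [simp]: "A \<triangle> (A \<triangle> B) = B"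
  by auto

lemma symdiff_empty [simp]: "A \<triangle> {} = A" "{} \<triangle> A = A"
  by auto

lemma symdiff_eq_empty_iff [simp]: "A \<triangle> B = {} \<longleftrightarrow> A = B"
  by auto

lemma symdiff_subset: "A \<subseteq> C \<Longrightarrow> B \<subseteq> C \<Longrightarrow> A \<triangle> B \<subseteq> C"
  by auto

lemma symdiff_eq_Un: "A \<triangle> B = (A - B) \<union> (B - A)"
  by auto

lemma symdiff_remove: "a \<in> A \<Longrightarrow> A \<triangle> {a} = A - {a}"
  by auto

lemmas symdiff_ac = symdiff_assoc symdiff_commute symdiff_left_commute

lemma image_symdiff:
  assumes "inj_on f C" "A \<subseteq> C" "B \<subseteq> C"
  shows "f ` (A \<triangle> B) = f ` A \<triangle> f ` B"
proof -
  have "f ` (A - B) = f ` A - f ` B" "f ` (B - A) = f ` B - f ` A"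
    by (rule inj_on_image_set_diff[OF assms(1)]; use assms in blast)+
  then show ?thesis
    by (simp only: symdiff_eq_Un image_Un)
qed

lemma card_Diff_insert_less: "finite A \<Longrightarrow> a \<in> A \<Longrightarrow> card (A - insert a B) < card A"
  by (rule psubset_card_mono) auto

text \<open>Paths cross arcs in both directions, so what propagates is a property shared by the two
  ends of every arc; hence the equivalence in the last premise. Most later arguments have this form,
  with only one or two arcs at which the property could change.\<close>

lemma connected_induct:
  assumes "wf_digraph G" "Digraph_Component.connected G" "x \<in> verts G" "y \<in> verts G" "Q x"
    and step: "\<And>e. e \<in> arcs G \<Longrightarrow> Q (tail G e) \<longleftrightarrow> Q (head G e)"
  shows "Q y"
proof -
  have "(x, y) \<in> rtrancl_on (verts G) (arcs_ends (with_proj (mk_symmetric G)))"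
    using assms(2-4) unfolding connected_def strongly_connected_def reachable_def
    by (simp add: mk_symmetric_def)
  then show ?thesis
    by (induction rule: rtrancl_on_induct)
      (use assms in \<open>auto simp: arcs_ends_def arc_to_ends_def mk_symmetric_def\<close>)
qed

text \<open>Converse of \<open>connected_induct\<close>: reachability from \<open>x\<close> is
  itself a property shared by the ends of each arc, and symmetry extends it to all pairs.\<close>

lemma connectedI:
  assumes "wf_digraph G" "x \<in> verts G"
    and ind: "\<And>Q y. \<lbrakk>Q x; \<And>e. e \<in> arcs G \<Longrightarrow> Q (tail G e) \<longleftrightarrow> Q (head G e); y \<in> verts G\<rbrakk> \<Longrightarrow> Q y"
  shows "Digraph_Component.connected G"
proof -
  interpret wf_digraph G by fact
  let ?R = "rtrancl_on (verts G) (arcs_ends (with_proj (mk_symmetric G)))"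
  have sym: "sym ?R"
    by (rule rtrancl_on_sym) (auto simp: sym_def arcs_ends_def arc_to_ends_def mk_symmetric_def)
  have adj: "(tail G e, head G e) \<in> ?R" "(head G e, tail G e) \<in> ?R" if "e \<in> arcs G" for e
  proof -
    have "(tail G e, head G e) \<in> arcs_ends (with_proj (mk_symmetric G))"
      using that by (auto simp: arcs_ends_def arc_to_ends_def mk_symmetric_def image_iff)
    then show "(tail G e, head G e) \<in> ?R"
      using that rtrancl_on_into_rtrancl_on[OF rtrancl_on_refl] by (metis head_in_verts tail_in_verts)
    then show "(head G e, tail G e) \<in> ?R"
      using sym by (meson symD)
  qed
  have from_x: "(x, y) \<in> ?R" if "y \<in> verts G" for y
  proof (rule ind[where Q = "\<lambda>y. (x, y) \<in> ?R"])
    show "(x, x) \<in> ?R" using assms(2) by simp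
    show "(x, tail G e) \<in> ?R \<longleftrightarrow> (x, head G e) \<in> ?R" if "e \<in> arcs G" for e
      using adj[OF that] rtrancl_on_trans by metis
  qed fact
  have "(y, z) \<in> ?R" if "y \<in> verts G" "z \<in> verts G" for y z
    using from_x[OF that(1)] from_x[OF that(2)] sym rtrancl_on_trans by (metis symD)
  then show ?thesis
    using assms(2) unfolding connected_def strongly_connected_def reachable_def
    by (auto simp: mk_symmetric_def)
qed

section \<open>Geodesics in a graph with a potential\<close>

locale potential_graph = wf_digraph +
  fixes P :: "'a \<Rightarrow> 'b set"
  assumes connected: "Digraph_Component.connected G"
    and potential: "e \<in> arcs G \<Longrightarrow> P (head G e) = P (tail G e) \<triangle> {e}"
begin

definition separating :: "'a \<Rightarrow> 'a \<Rightarrow> 'b set" where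
  "separating x y = P x \<triangle> P y"

definition joins :: "'b \<Rightarrow> 'a \<Rightarrow> 'a \<Rightarrow> bool" where
  "joins e x y \<longleftrightarrow> e \<in> arcs G \<and> (tail G e = x \<and> head G e = y \<or> head G e = x \<and> tail G e = y)"

lemma separating_self [simp]: "separating x x = {}"
  by (simp add: separating_def)

lemma separating_commute: "separating x y = separating y x"
  by (simp add: separating_def symdiff_commute)

lemma separating_head: "e \<in> arcs G \<Longrightarrow> separating x (head G e) = separating x (tail G e) \<triangle> {e}"
  by (auto simp: separating_def potential)

lemma joins_in_verts: "joins e x y \<Longrightarrow> x \<in> verts G \<and> y \<in> verts G"
  by (auto simp: joins_def)

lemma joins_in_arcs: "joins e x y \<Longrightarrow> e \<in> arcs G"
  by (auto simp: joins_def)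

lemma joins_separating: "joins e x y \<Longrightarrow> separating z y = separating z x \<triangle> {e}"
  by (auto simp: joins_def separating_def potential)

lemma joins_separating1: "joins e x y \<Longrightarrow> separating x y = {e}"
  using joins_separating[of e x y x] by simp

lemma joins_separating_left: "joins e x y \<Longrightarrow> separating y z = separating x z \<triangle> {e}"
  by (metis joins_separating separating_commute)

lemma joins_separating_ends:
  assumes "joins e x y"
  shows "separating x (tail G e) \<subseteq> {e}" "separating x (head G e) \<subseteq> {e}"
  using joins_separating1[OF assms] assms unfolding joins_def by (metis empty_subsetI separating_self subset_refl)+

lemma induct:
  assumes "x \<in> verts G" "y \<in> verts G" "Q x"
    and "\<And>e. e \<in> arcs G \<Longrightarrow> Q (tail G e) \<longleftrightarrow> Q (head G e)"
  shows "Q y"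
  using connected_induct[OF wf_digraph connected assms(1,2), of Q] assms(3,4) by blast

text \<open>Crossing an arc adds or removes a single element. Finiteness matters because distances
  are measured by \<open>card\<close>, which is 0 on infinite sets.\<close>

lemma finite_separating:
  assumes "x \<in> verts G" "y \<in> verts G"
  shows "finite (separating x y) \<and> separating x y \<subseteq> arcs G"
proof (rule induct[OF assms])
  fix e assume e: "e \<in> arcs G"
  have fin: "finite (A \<triangle> {e}) \<longleftrightarrow> finite A" for A
  proof
    show "finite (A \<triangle> {e})" if "finite A"
      by (rule finite_subset[of _ "insert e A"]) (use that in auto)
    show "finite A" if "finite (A \<triangle> {e})"
      by (rule finite_subset[of _ "insert e (A \<triangle> {e})"]) (use that in auto)
  qed
  have "separating x (tail G e) \<triangle> {e} \<subseteq> arcs G \<longleftrightarrow> separating x (tail G e) \<subseteq> arcs G"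
    using e by auto
  then show "finite (separating x (tail G e)) \<and> separating x (tail G e) \<subseteq> arcs G \<longleftrightarrow>
      finite (separating x (head G e)) \<and> separating x (head G e) \<subseteq> arcs G"
    by (simp add: separating_head[OF e] fin)
qed simp

text \<open>A geodesic has only one first arc. While the endpoint moves away from \<open>x\<close>,
  the set of separating arcs could acquire \<open>e\<close> or \<open>f\<close> only on crossing
  that arc, but both ends of \<open>e\<close> are separated from \<open>x\<close> by at most
  \<open>e\<close>, so \<open>f\<close> is absent there, and vice versa. Hence the two never occur
  together.\<close>

lemma separating_arc_unique:
  assumes "joins e x x'" "joins f x x''" "e \<in> separating x y" "f \<in> separating x y" "y \<in> verts G"
  shows "e = f"
proof (rule ccontr)
  assume "e \<noteq> f"
  have x: "x \<in> verts G" using assms(1) joins_in_verts by blast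
  have "\<not> (e \<in> separating x y \<and> f \<in> separating x y)"
  proof (rule induct[OF x assms(5)])
    fix g assume g: "g \<in> arcs G"
    consider "g = e" | "g = f" | "g \<noteq> e" "g \<noteq> f" by blast
    then show "\<not> (e \<in> separating x (tail G g) \<and> f \<in> separating x (tail G g)) \<longleftrightarrow>
      \<not> (e \<in> separating x (head G g) \<and> f \<in> separating x (head G g))"
    proof cases
      case 1
      then have "f \<notin> separating x (tail G g) \<and> f \<notin> separating x (head G g)"
        using \<open>e \<noteq> f\<close> joins_separating_ends[OF assms(1)] by blast
      then show ?thesis by blast
    next
      case 2
      then have "e \<notin> separating x (tail G g) \<and> e \<notin> separating x (head G g)"
        using \<open>e \<noteq> f\<close> joins_separating_ends[OF assms(2)] by blast
      then show ?thesis by blast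
    next
      case 3
      then show ?thesis by (simp add: separating_head[OF g])
    qed
  qed simp
  then show False using assms by blast
qed

text \<open>The first arc survives when the endpoint crosses \<open>g\<close>, unless it is
  \<open>g\<close> itself; in that case the crossing leads back to \<open>x\<close>. Removing the
  first arc gives the smaller separating set used in all inductions on distance.\<close>

lemma separating_arc_exists:
  assumes "x \<in> verts G" "y \<in> verts G" "x \<noteq> y"
  obtains e x' where "joins e x x'" "e \<in> separating x y" "separating x' y = separating x y - {e}"
proof -
  have "x = y \<or> (\<exists>e x'. joins e x x' \<and> e \<in> separating x y)"
  proof (rule induct[OF assms(1,2)])
    fix g assume g: "g \<in> arcs G"
    define a b where "a = tail G g" and "b = head G g"
    have j: "joins g a b" "joins g b a" using g by (auto simp: joins_def a_def b_def)
    have "x = v \<or> (\<exists>e x'. joins e x x' \<and> e \<in> separating x v)"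
      if guv: "joins g u v" and u: "x = u \<or> (\<exists>e x'. joins e x x' \<and> e \<in> separating x u)" for u v
    proof (cases "x = u")
      case True
      then show ?thesis using guv joins_separating1 by blast
    next
      case False
      then obtain e x' where e: "joins e x x'" "e \<in> separating x u" using u by blast
      show ?thesis
      proof (cases "e = g")
        case True
        then show ?thesis using e(1) guv False unfolding joins_def by metis
      next
        case False
        then have "e \<in> separating x v" using e(2) by (simp add: joins_separating[OF guv])
        then show ?thesis using e(1) by blast
      qed
    qed
    from this[OF j(1)] this[OF j(2)]
    show "(x = tail G g \<or> (\<exists>e x'. joins e x x' \<and> e \<in> separating x (tail G g))) \<longleftrightarrow>
      (x = head G g \<or> (\<exists>e x'. joins e x x' \<and> e \<in> separating x (head G g)))"
      unfolding a_def b_def by (rule iffI)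
  qed simp
  then obtain e x' where e: "joins e x x'" "e \<in> separating x y" using assms(3) by blast
  then have "separating x' y = separating x y - {e}"
    by (simp add: joins_separating_left[OF e(1)] symdiff_remove)
  then show ?thesis using that e by blast
qed

text \<open>Each step switches one element of the symmetric difference, and distinctness prevents
  cancellation. A closed walk without repeated edges is therefore empty, which excludes
  cycles.\<close>

lemma awalk_both_orientations_separating:
  assumes "pre_digraph.cas (both_orientations G) x p y" "set p \<subseteq> arcs (both_orientations G)"
    "distinct (map fst p)"
  shows "separating x y = set (map fst p)"
  using assms
proof (induction p arbitrary: x)
  case Nil
  then show ?case by (simp add: pre_digraph.cas.simps)
next
  case (Cons a p)
  obtain e b where a: "a = (e, b)" by (cases a)
  define z where "z = head (both_orientations G) a"
  have "pre_digraph.cas (both_orientations G) z p y" and x: "tail (both_orientations G) a = x"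
    using Cons.prems(1) by (auto simp: pre_digraph.cas.simps z_def)
  then have "separating z y = set (map fst p)"
    using Cons by simp
  moreover have "joins e z x"
    using Cons.prems(2) x a unfolding joins_def z_def both_orientations_def by auto
  ultimately show ?case
    using joins_separating_left[of e z x y] Cons.prems(3) a
    by (simp add: symdiff_def del: set_map) blast
qed

lemma unoriented_tree: "unoriented_tree G"
  unfolding unoriented_tree_def
proof (intro conjI notI connected)
  assume "\<exists>p. pre_digraph.cycle (both_orientations G) p \<and> distinct (map fst p)"
  then obtain p u where p: "pre_digraph.awalk (both_orientations G) u p u" "p \<noteq> []"
    "distinct (map fst p)"
    by (auto simp: pre_digraph.cycle_def)
  then have "separating u u = set (map fst p)"
    by (intro awalk_both_orientations_separating) (auto simp: pre_digraph.awalk_def)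
  then show False using p(2) by simp
qed

section \<open>Automorphisms and their fixed vertices\<close>

definition automorphism :: "('a \<Rightarrow> 'a) \<Rightarrow> ('b \<Rightarrow> 'b) \<Rightarrow> bool" where
  "automorphism \<alpha> \<beta> \<longleftrightarrow> \<alpha> ` verts G \<subseteq> verts G \<and> \<beta> ` arcs G \<subseteq> arcs G \<and> inj_on \<beta> (arcs G) \<and>
    (\<forall>e\<in>arcs G. tail G (\<beta> e) = \<alpha> (tail G e) \<and> head G (\<beta> e) = \<alpha> (head G e))"

lemma automorphism_vert: "automorphism \<alpha> \<beta> \<Longrightarrow> x \<in> verts G \<Longrightarrow> \<alpha> x \<in> verts G"
  by (auto simp: automorphism_def)

lemma automorphism_joins: "automorphism \<alpha> \<beta> \<Longrightarrow> joins e x y \<Longrightarrow> joins (\<beta> e) (\<alpha> x) (\<alpha> y)"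
  by (auto simp: automorphism_def joins_def)

text \<open>This is where preservation of orientations enters: an edge cannot be inverted. Otherwise
  a periodic automorphism might fix only the midpoint of an edge.\<close>

lemma automorphism_fixes_ends:
  "automorphism \<alpha> \<beta> \<Longrightarrow> joins e x y \<Longrightarrow> \<beta> e = e \<Longrightarrow> \<alpha> x = x \<and> \<alpha> y = y"
  unfolding automorphism_def joins_def by metis

text \<open>The potential need not be respected by \<open>\<alpha>\<close>, but its differences are:
  when \<open>y\<close> crosses \<open>e\<close>, both sides switch \<open>\<beta> e\<close>, on the
  right by injectivity of \<open>\<beta>\<close>.\<close>

lemma automorphism_separating:
  assumes "automorphism \<alpha> \<beta>" "x \<in> verts G" "y \<in> verts G"
  shows "separating (\<alpha> x) (\<alpha> y) = \<beta> ` separating x y"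
proof -
  have inj: "inj_on \<beta> (arcs G)" using assms(1) by (simp add: automorphism_def)
  have "y \<in> verts G \<and> separating (\<alpha> x) (\<alpha> y) = \<beta> ` separating x y"
  proof (rule induct[OF assms(2,3)])
    fix e assume e: "e \<in> arcs G"
    define A where "A = separating x (tail G e)"
    have A: "A \<subseteq> arcs G" using finite_separating[OF assms(2), of "tail G e"] e by (simp add: A_def)
    have 1: "separating (\<alpha> x) (\<alpha> (head G e)) = separating (\<alpha> x) (\<alpha> (tail G e)) \<triangle> {\<beta> e}"
      using joins_separating[OF automorphism_joins[OF assms(1), of e "tail G e" "head G e"], of "\<alpha> x"] e
      by (simp add: joins_def)
    have 2: "\<beta> ` separating x (head G e) = \<beta> ` A \<triangle> {\<beta> e}"
      using e A by (simp add: separating_head[OF e] image_symdiff[OF inj] A_def[symmetric])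
    have "C \<triangle> D = B \<triangle> D \<longleftrightarrow> C = B" for B C D :: "'b set"
      by (metis symdiff_assoc symdiff_self symdiff_empty(1))
    then show "(tail G e \<in> verts G \<and> separating (\<alpha> x) (\<alpha> (tail G e)) = \<beta> ` separating x (tail G e)) \<longleftrightarrow>
      (head G e \<in> verts G \<and> separating (\<alpha> x) (\<alpha> (head G e)) = \<beta> ` separating x (head G e))"
      using e by (simp add: 1 2 A_def[symmetric])
  qed (use assms in simp)
  then show ?thesis by blast
qed

text \<open>Fixed vertices are joined by fixed arcs. The geodesic from \<open>x\<close> to
  \<open>y\<close> is mapped to itself, so its first arc \<open>e\<close> and
  \<open>\<beta> e\<close> are both first arcs from \<open>x\<close> towards \<open>y\<close>, hence
  equal. The other end of \<open>e\<close> is then fixed and nearer to \<open>y\<close>.\<close>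

lemma fixed_subgraph_induct:
  assumes "automorphism \<alpha> \<beta>" "x \<in> verts G" "\<alpha> x = x" "y \<in> verts G" "\<alpha> y = y" "Q y"
    and step: "\<And>e. e \<in> arcs G \<Longrightarrow> \<beta> e = e \<Longrightarrow> Q (tail G e) \<longleftrightarrow> Q (head G e)"
  shows "Q x"
  using assms(2,3)
proof (induction "card (separating x y)" arbitrary: x rule: less_induct)
  case less
  show ?case
  proof (cases "x = y")
    case False
    then obtain e x' where e: "joins e x x'" "e \<in> separating x y" "separating x' y = separating x y - {e}"
      using separating_arc_exists less.prems assms(4) by metis
    have "\<beta> e \<in> separating x y"
      using automorphism_separating[OF assms(1) less.prems(1) assms(4)] less.prems assms(5) e(2)
      by (metis imageI)
    moreover have "joins (\<beta> e) x (\<alpha> x')"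
      using automorphism_joins[OF assms(1) e(1)] less.prems by simp
    ultimately have fixed: "\<beta> e = e"
      using separating_arc_unique e(1,2) assms(4) by blast
    have "card (separating x' y) < card (separating x y)"
      using e finite_separating[OF less.prems(1) assms(4)] by (metis card_Diff1_less)
    then have "Q x'"
      using less.hyps automorphism_fixes_ends[OF assms(1) e(1) fixed] joins_in_verts[OF e(1)] by blast
    then show ?thesis
      using step[OF joins_in_arcs[OF e(1)] fixed] e(1) unfolding joins_def by metis
  qed (use assms(6) in simp)
qed

text \<open>
  If \<open>x\<close> is moved the least and \<open>e\<close> is the first arc from \<open>x\<close> to \<open>\<alpha> x\<close>, then \<open>\<alpha>\<close> maps the half-tree
  behind \<open>e\<close> into itself; it contains \<open>\<alpha> x\<close>, hence all further iterates, but not \<open>x\<close>.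
\<close>

lemma fixed_vertex_of_periodic:
  assumes aut: "automorphism \<alpha> \<beta>" and "x0 \<in> verts G" "k > 0" "\<And>x. x \<in> verts G \<Longrightarrow> (\<alpha> ^^ k) x = x"
  shows "\<exists>x\<in>verts G. \<alpha> x = x"
proof (rule ccontr)
  assume nofix: "\<not> (\<exists>x\<in>verts G. \<alpha> x = x)"
  obtain x where x: "x \<in> verts G" and
    min: "\<And>z. z \<in> verts G \<Longrightarrow> card (separating x (\<alpha> x)) \<le> card (separating z (\<alpha> z))"
    using ex_has_least_nat[of "\<lambda>z. z \<in> verts G" x0 "\<lambda>z. card (separating z (\<alpha> z))"] assms(2) by metis
  note ax = automorphism_vert[OF aut x]
  obtain e x' where e: "joins e x x'" "e \<in> separating x (\<alpha> x)"
    "separating x' (\<alpha> x) = separating x (\<alpha> x) - {e}"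
    using separating_arc_exists[OF x ax] nofix x by metis
  note x' = joins_in_verts[OF e(1)]
  note \<beta>e = automorphism_joins[OF aut e(1)]
  have ne: "\<beta> e \<noteq> e" using automorphism_fixes_ends[OF aut e(1)] nofix x by blast
  \<comment> \<open>Otherwise the geodesic from \<open>x\<close> to \<open>\<alpha> x\<close> also
    ends with \<open>\<beta> e\<close>, and \<open>x'\<close> is moved less than \<open>x\<close>:
    both \<open>e\<close> and \<open>\<beta> e\<close> drop out.\<close>
  have "\<beta> e \<notin> separating x (\<alpha> x)"
  proof
    assume "\<beta> e \<in> separating x (\<alpha> x)"
    then have "separating x' (\<alpha> x') = separating x (\<alpha> x) - {e, \<beta> e}"
      using ne by (simp add: joins_separating[OF \<beta>e] e(3) symdiff_remove Diff_insert2[symmetric] insert_commute)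
    then have "card (separating x' (\<alpha> x')) < card (separating x (\<alpha> x))"
      using card_Diff_insert_less e(2) finite_separating[OF x ax] by metis
    then show False using min[of x'] x' by simp
  qed
  then have \<beta>e_nsep: "\<beta> e \<notin> separating (\<alpha> x) x" by (simp add: separating_commute)
  \<comment> \<open>This is the inclusion of half-trees. It could fail only from the crossing of
    \<open>e\<close> or \<open>\<beta> e\<close> onwards. At both ends of \<open>e\<close> the
    premise is false, and at both ends of \<open>\<beta> e\<close> the conclusion is true, so it
    never fails.\<close>
  have nested: "\<beta> e \<in> separating (\<alpha> x) z \<longrightarrow> e \<in> separating x z" if "z \<in> verts G" for z
  proof (rule induct[OF x that])
    fix g assume g: "g \<in> arcs G"
    consider "g = e" | "g = \<beta> e" | "g \<noteq> e" "g \<noteq> \<beta> e" by blast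
    then show "(\<beta> e \<in> separating (\<alpha> x) (tail G g) \<longrightarrow> e \<in> separating x (tail G g)) \<longleftrightarrow>
      (\<beta> e \<in> separating (\<alpha> x) (head G g) \<longrightarrow> e \<in> separating x (head G g))"
    proof cases
      case 1
      have "\<beta> e \<notin> separating (\<alpha> x) x'"
        using joins_separating[OF e(1), of "\<alpha> x"] ne \<beta>e_nsep by simp
      then show ?thesis
        using 1 e(1) \<beta>e_nsep unfolding joins_def by (elim conjE disjE) simp_all
    next
      case 2
      have "e \<in> separating x (\<alpha> x')"
        using joins_separating[OF \<beta>e, of x] ne e(2) by simp
      then show ?thesis
        using 2 \<beta>e e(2) unfolding joins_def by (elim conjE disjE) simp_all
    next
      case 3
      then show ?thesis by (simp add: separating_head[OF g])
    qed
  qed (simp add: \<beta>e_nsep)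
  have iter: "(\<alpha> ^^ n) x \<in> verts G" for n
    by (induction n) (auto simp: x automorphism_vert[OF aut])
  have "e \<in> separating x ((\<alpha> ^^ Suc n) x)" for n
  proof (induction n)
    case (Suc n)
    then have "\<beta> e \<in> separating (\<alpha> x) (\<alpha> ((\<alpha> ^^ Suc n) x))"
      using automorphism_separating[OF aut x iter] by blast
    then show ?case using nested iter[of "Suc (Suc n)"] by simp
  qed (use e in simp)
  moreover obtain n where "k = Suc n" using assms(3) not0_implies_Suc by blast
  ultimately show False using assms(4)[OF x] by (metis empty_iff separating_self)
qed

lemma automorphism_comp:
  assumes "automorphism \<alpha> \<beta>" "automorphism \<alpha>' \<beta>'"
  shows "automorphism (\<alpha> \<circ> \<alpha>') (\<beta> \<circ> \<beta>')"
proof -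
  have "inj_on (\<beta> \<circ> \<beta>') (arcs G)"
  proof (rule comp_inj_on)
    show "inj_on \<beta>' (arcs G)"
      using assms(2) by (simp add: automorphism_def)
    show "inj_on \<beta> (\<beta>' ` arcs G)"
      by (rule inj_on_subset[of \<beta> "arcs G"]) (use assms in \<open>simp_all add: automorphism_def\<close>)
  qed
  then show ?thesis
    using assms unfolding automorphism_def image_subset_iff by simp
qed

text \<open>A vertex fixed by the composite is sent to the same place by both involutions. If it is
  moved, one step along the geodesic towards its image gives another vertex fixed by the composite
  that is moved less, so a least moved one is fixed by both.\<close>

lemma common_fixed_vertex:
  assumes a: "automorphism \<alpha> \<beta>" and b: "automorphism \<alpha>' \<beta>'"
    and inv: "\<And>x. x \<in> verts G \<Longrightarrow> \<alpha> (\<alpha> x) = x" "\<And>e. e \<in> arcs G \<Longrightarrow> \<beta> (\<beta> e) = e"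
      "\<And>x. x \<in> verts G \<Longrightarrow> \<alpha>' (\<alpha>' x) = x"
    and "x0 \<in> verts G" "k > 0" "\<And>x. x \<in> verts G \<Longrightarrow> ((\<alpha> \<circ> \<alpha>') ^^ k) x = x"
  shows "\<exists>x\<in>verts G. \<alpha> x = x \<and> \<alpha>' x = x"
proof -
  note c = automorphism_comp[OF a b]
  obtain x1 where x1: "x1 \<in> verts G" "\<alpha> (\<alpha>' x1) = x1"
    using fixed_vertex_of_periodic[OF c assms(6,7,8)] by auto
  then obtain x where x: "x \<in> verts G" "\<alpha> (\<alpha>' x) = x" and
    min: "\<And>z. z \<in> verts G \<Longrightarrow> \<alpha> (\<alpha>' z) = z \<Longrightarrow> card (separating x (\<alpha> x)) \<le> card (separating z (\<alpha> z))"
    using ex_has_least_nat[of "\<lambda>z. z \<in> verts G \<and> \<alpha> (\<alpha>' z) = z" x1 "\<lambda>z. card (separating z (\<alpha> z))"]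
    by metis
  have same: "\<alpha>' x = \<alpha> x"
    using inv(1)[OF automorphism_vert[OF b x(1)]] x(2) by simp
  note ax = automorphism_vert[OF a x(1)]
  have "\<alpha> x = x"
  proof (rule ccontr)
    assume "\<alpha> x \<noteq> x"
    then obtain e x' where e: "joins e x x'" "e \<in> separating x (\<alpha> x)"
      "separating x' (\<alpha> x) = separating x (\<alpha> x) - {e}"
      using separating_arc_exists[OF x(1) ax] by metis
    note x' = joins_in_verts[OF e(1)]
    \<comment> \<open>Both involutions exchange \<open>x\<close> and \<open>\<alpha> x\<close> and
      reverse the geodesic between them. Hence \<open>\<beta> e\<close> and
      \<open>\<beta>' e\<close> are both its first arc seen from \<open>\<alpha> x\<close>, and
      coincide.\<close>
    have "separating (\<alpha> x) x = \<beta> ` separating x (\<alpha> x)"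
      using automorphism_separating[OF a x(1) ax] inv(1)[OF x(1)] by simp
    moreover have "separating (\<alpha> x) x = \<beta>' ` separating x (\<alpha> x)"
      using automorphism_separating[OF b x(1) ax] inv(3)[OF x(1)] same by simp
    ultimately have sep: "\<beta> e \<in> separating (\<alpha> x) x" "\<beta>' e \<in> separating (\<alpha> x) x"
      using e(2) by blast+
    have j: "joins (\<beta> e) (\<alpha> x) (\<alpha> x')" "joins (\<beta>' e) (\<alpha> x) (\<alpha>' x')"
      using automorphism_joins[OF a e(1)] automorphism_joins[OF b e(1)] same by simp_all
    then have "\<beta> e = \<beta>' e"
      using separating_arc_unique sep x(1) by blast
    then have "(\<beta> \<circ> \<beta>') e = e"
      using inv(2)[OF joins_in_arcs[OF e(1)]] by simp
    then have cx': "\<alpha> (\<alpha>' x') = x'"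
      using automorphism_fixes_ends[OF c e(1)] by simp
    have ne: "\<beta> e \<noteq> e" using automorphism_fixes_ends[OF a e(1)] \<open>\<alpha> x \<noteq> x\<close> by blast
    have "separating x' (\<alpha> x') = separating x (\<alpha> x) - {e, \<beta> e}"
      using ne sep(1)
      by (simp add: joins_separating[OF j(1)] e(3) symdiff_remove Diff_insert2[symmetric] insert_commute
          separating_commute[of "\<alpha> x"])
    then have "card (separating x' (\<alpha> x')) < card (separating x (\<alpha> x))"
      using card_Diff_insert_less e(2) finite_separating[OF x(1) ax] by metis
    then show False using min[of x'] x' cx' by simp
  qed
  then show ?thesis using x same by metis
qed

end

section \<open>A potential on every tree\<close>

definition odd_arcs :: "('e \<times> bool) list \<Rightarrow> 'e set" where
  "odd_arcs p = foldr (\<lambda>a A. {fst a} \<triangle> A) p {}"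

lemma odd_arcs_simps [simp]:
  "odd_arcs [] = {}"
  "odd_arcs (a # p) = {fst a} \<triangle> odd_arcs p"
  by (simp_all add: odd_arcs_def)

lemma odd_arcs_append [simp]: "odd_arcs (p @ q) = odd_arcs p \<triangle> odd_arcs q"
  by (induction p) (simp_all add: symdiff_assoc)

lemma odd_arcs_rev [simp]: "odd_arcs (rev p) = odd_arcs p"
  by (induction p) (simp_all add: symdiff_commute)

lemma odd_arcs_flip [simp]: "odd_arcs (map (\<lambda>(e, b). (e, f b)) p) = odd_arcs p"
  by (induction p) (simp_all add: case_prod_beta)

lemma odd_arcs_subset: "odd_arcs p \<subseteq> fst ` set p"
  by (induction p) auto

lemma both_orientations_simps [simp]:
  "verts (both_orientations G) = verts G"
  "arcs (both_orientations G) = arcs G \<times> UNIV"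
  "tail (both_orientations G) (e, b) = (if b then tail G e else head G e)"
  "head (both_orientations G) (e, b) = (if b then head G e else tail G e)"
  by (simp_all add: both_orientations_def)

lemma wf_both_orientations: "wf_digraph G \<Longrightarrow> wf_digraph (both_orientations G)"
  by (auto simp: wf_digraph_def)

text \<open>A shortest closed walk violating this is a cycle without repeated edges.\<close>

lemma odd_arcs_closed_walk:
  assumes "wf_digraph G" "unoriented_tree G"
    and "pre_digraph.awalk (both_orientations G) u p u"
  shows "odd_arcs p = {}"
proof -
  let ?B = "both_orientations G"
  interpret B: wf_digraph ?B using wf_both_orientations assms(1) .
  show ?thesis using assms(3)
  proof (induction "length p" arbitrary: p u rule: less_induct)
    case less
    \<comment> \<open>A closed subwalk \<open>b\<close> can be cut out: both it and the remaining
      closed walk are shorter, and their sets of odd arcs combine to that of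
      \<open>p\<close>.\<close>
    have split: "odd_arcs p = {}"
      if "p = a @ b @ c" "b \<noteq> []" "a @ c \<noteq> []" "B.awalk u a w" "B.awalk w b w" "B.awalk w c u"
      for a b c w
    proof -
      have "length b < length p" "length (a @ c) < length p"
        using that(1-3) by auto
      then have "odd_arcs b = {}" "odd_arcs (a @ c) = {}"
        using less.hyps that(4-6) B.awalk_appendI by blast+
      then show ?thesis using that(1) by simp
    qed
    show ?case
    proof (cases p)
      case (Cons x p')
      show ?thesis
      proof (cases "distinct (tl (B.awalk_verts u p))")
        case False
        have x: "B.awalk u [x] (head ?B x)" and p': "B.awalk (head ?B x) p' u"
          using less.prems Cons by (auto simp: B.awalk_Cons_iff B.awalk_Nil_iff)
        obtain q r s w where "p' = q @ r @ s" "0 < length r" "B.awalk (head ?B x) q w"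
          "B.awalk w r w" "B.awalk w s u"
          using B.awalk_not_distinct_decomp[OF p'] False Cons by auto
        then show ?thesis
          using split[of "x # q" r s w] Cons B.awalk_appendI[OF x] by simp
      next
        case True
        then have "B.cycle p" using less.prems Cons by (auto simp: B.cycle_def)
        then have "\<not> distinct (map fst p)"
          using assms(2) by (auto simp: unoriented_tree_def)
        then obtain xs e ys zs where "map fst p = xs @ [e] @ ys @ [e] @ zs"
          using not_distinct_decomp by blast
        then obtain a b c y z where p: "p = a @ [y] @ b @ [z] @ c" and yz: "fst y = e" "fst z = e"
          by (auto simp: map_eq_append_conv map_eq_Cons_conv Cons_eq_map_conv append_eq_map_conv)
        define v where "v = tail ?B y"
        have a: "B.awalk u a v" and y: "B.awalk v [y] (head ?B y)"
          and b: "B.awalk (head ?B y) b (tail ?B z)" and z: "B.awalk (tail ?B z) [z] (head ?B z)"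
          and c: "B.awalk (head ?B z) c u"
          using less.prems unfolding p v_def
          by (auto simp: B.awalk_Cons_iff B.awalk_Nil_iff)
        \<comment> \<open>An edge passed twice in the same direction closes up the piece starting
          with \<open>y\<close> and ending before \<open>z\<close>. If it is passed in opposite
          directions, the piece between the passages is closed, the rest is closed without them, and
          the two passages cancel modulo 2.\<close>
        show ?thesis
        proof (cases "y = z")
          case True
          then show ?thesis
            using split[of a "[y] @ b" "[z] @ c" v] p a b c y z B.awalk_appendI unfolding v_def
            by (metis append_assoc append_is_Nil_conv not_Cons_self2)
        next
          case False
          then have opp: "tail ?B z = head ?B y" "head ?B z = v"
            using yz by (cases y; cases z; auto simp: v_def split: if_splits)+
          then have "B.awalk u (a @ c) u"
            using B.awalk_appendI[OF a] c by simp
          then have "odd_arcs b = {}" "odd_arcs (a @ c) = {}"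
            using less.hyps[of b "head ?B y"] less.hyps[OF _ \<open>B.awalk u (a @ c) u\<close>] b opp p by simp_all
          then show ?thesis using yz by (simp add: p symdiff_ac)
        qed
      qed
    qed simp
  qed
qed

lemma awalk_reverse:
  assumes "wf_digraph G" "pre_digraph.awalk (both_orientations G) u p v"
  shows "pre_digraph.awalk (both_orientations G) v (rev (map (\<lambda>(e, b). (e, \<not> b)) p)) u"
proof -
  interpret B: wf_digraph "both_orientations G" using wf_both_orientations assms(1) .
  interpret wf_digraph G by fact
  show ?thesis using assms(2)
  proof (induction p arbitrary: u)
    case (Cons a p)
    obtain e b where a: "a = (e, b)" by (cases a)
    have "B.awalk v (rev (map (\<lambda>(e, b). (e, \<not> b)) p)) (head (both_orientations G) a)"
      using Cons by (simp add: B.awalk_Cons_iff)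
    moreover have "B.awalk (head (both_orientations G) a) [(e, \<not> b)] u"
      using Cons.prems a by (auto simp: B.awalk_Cons_iff B.awalk_Nil_iff)
    ultimately show ?case using a B.awalk_appendI by simp
  qed (simp add: B.awalk_Nil_iff)
qed

text \<open>Converse of \<open>potential_graph.unoriented_tree\<close>. The potential of
  \<open>v\<close> consists of the arcs passed an odd number of times by a walk from a root; two
  walks to \<open>v\<close> agree because one followed by the reverse of the other is
  closed.\<close>

lemma unoriented_tree_potential:
  assumes "wf_digraph G" "unoriented_tree G"
  obtains q where "\<And>v. v \<in> verts G \<Longrightarrow> q v \<subseteq> arcs G"
    "\<And>e. e \<in> arcs G \<Longrightarrow> q (head G e) = q (tail G e) \<triangle> {e}"
proof -
  let ?B = "both_orientations G"
  interpret wf_digraph G by fact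
  interpret B: wf_digraph ?B using wf_both_orientations assms(1) .
  have conn: "Digraph_Component.connected G" using assms(2) by (simp add: unoriented_tree_def)
  then obtain r where r: "r \<in> verts G"
    by (auto simp: connected_def strongly_connected_def mk_symmetric_def)
  have arc: "B.awalk (tail G e) [(e, True)] (head G e)" "B.awalk (head G e) [(e, False)] (tail G e)"
    if "e \<in> arcs G" for e
    using that by (auto simp: B.awalk_Cons_iff B.awalk_Nil_iff)
  have ex: "\<exists>p. B.awalk r p v" if "v \<in> verts G" for v
  proof (rule connected_induct[OF assms(1) conn r that])
    show "\<exists>p. B.awalk r p r" using r by (auto simp: B.awalk_Nil_iff intro!: exI[of _ "[]"])
    show "(\<exists>p. B.awalk r p (tail G e)) \<longleftrightarrow> (\<exists>p. B.awalk r p (head G e))" if "e \<in> arcs G" for e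
      using arc[OF that] B.awalk_appendI by blast
  qed
  have unique: "odd_arcs p = odd_arcs p'" if "B.awalk r p v" "B.awalk r p' v" for p p' v
    using odd_arcs_closed_walk[OF assms B.awalk_appendI[OF that(1) awalk_reverse[OF assms(1) that(2)]]]
    by simp
  define q where "q v = odd_arcs (SOME p. B.awalk r p v)" for v
  have q: "q v = odd_arcs p" if "B.awalk r p v" for p v
    unfolding q_def using unique[OF someI[of "\<lambda>p. B.awalk r p v"] that] that by blast
  show thesis
  proof (rule that)
    show "q v \<subseteq> arcs G" if "v \<in> verts G" for v
    proof -
      obtain p where p: "B.awalk r p v" using ex[OF \<open>v \<in> verts G\<close>] by blast
      then have "set p \<subseteq> arcs ?B" by blast
      then have "fst ` set p \<subseteq> arcs G" by auto
      then show ?thesis using odd_arcs_subset[of p] q[OF p] by simp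
    qed
    show "q (head G e) = q (tail G e) \<triangle> {e}" if "e \<in> arcs G" for e
    proof -
      obtain p where p: "B.awalk r p (tail G e)"
        using ex[OF tail_in_verts[OF \<open>e \<in> arcs G\<close>]] by blast
      show ?thesis
        using q[OF p] q[OF B.awalk_appendI[OF p arc(1)[OF \<open>e \<in> arcs G\<close>]]] by simp
    qed
  qed
qed

section \<open>Homomorphisms from presented groups\<close>

context group
begin

fun word_value :: "('g \<Rightarrow> 'a) \<Rightarrow> 'g word \<Rightarrow> 'a" where
  "word_value f [] = \<one>"
| "word_value f ((x, b) # w) = (if b then f x else inv (f x)) \<otimes> word_value f w"

lemma word_value_closed [simp]: "f \<in> X \<rightarrow> carrier G \<Longrightarrow> w \<in> words X \<Longrightarrow> word_value f w \<in> carrier G"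
  by (induction f w rule: word_value.induct) (auto simp: words_def Pi_iff)

lemma word_value_append:
  assumes f: "f \<in> X \<rightarrow> carrier G" and "v \<in> words X" "w \<in> words X"
  shows "word_value f (v @ w) = word_value f v \<otimes> word_value f w"
  using assms(2)
proof (induction v)
  case (Cons l v)
  obtain x b where l: "l = (x, b)" by (cases l)
  have "x \<in> X" "v \<in> words X" using Cons.prems l by (auto simp: words_def)
  moreover from this have "(if b then f x else inv (f x)) \<in> carrier G" using f by auto
  ultimately show ?case
    using Cons.IH l word_value_closed[OF f] assms(3) by (simp add: m_assoc)
qed (use assms word_value_closed[OF f] in simp)

lemma word_value_pres_eq:
  assumes f: "f \<in> X \<rightarrow> carrier G" and R: "\<And>r. r \<in> R \<Longrightarrow> r \<in> words X \<Longrightarrow> word_value f r = \<one>"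
    and "pres_eq X R v w"
  shows "word_value f v = word_value f w"
  using assms(3)
proof (induction rule: pres_eq.induct)
  case (cancel u v x b)
  have "f x \<in> carrier G" using cancel f by auto
  then have l: "[(x, b), (x, \<not> b)] \<in> words X" "word_value f [(x, b), (x, \<not> b)] = \<one>"
    using cancel by (auto simp: words_def)
  have "[(x, b), (x, \<not> b)] @ v \<in> words X" using cancel by (simp add: words_def)
  then have "word_value f (u @ [(x, b), (x, \<not> b)] @ v) = word_value f u \<otimes> word_value f v"
    using cancel word_value_append[OF f cancel(1)] word_value_append[OF f l(1) cancel(2)]
      word_value_closed[OF f] l(2) by simp
  then show ?case using word_value_append[OF f] cancel by simp
next
  case (relator u v r)
  have "r @ v \<in> words X" using relator by (simp add: words_def)
  then have "word_value f (u @ r @ v) = word_value f u \<otimes> word_value f v"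
    using relator word_value_append[OF f relator(1)] word_value_append[OF f relator(4,2)]
      word_value_closed[OF f] R by simp
  then show ?case using word_value_append[OF f] relator by simp
qed simp_all

text \<open>The value at a class is read off from a chosen representative, and
  \<open>word_value_pres_eq\<close> makes the choice irrelevant. The guard
  \<open>r \<in> words X\<close> mirrors the rule \<open>relator\<close>, which applies only
  relators over \<open>X\<close>.\<close>

lemma von_dyck:
  assumes f: "f \<in> X \<rightarrow> carrier G" and R: "\<And>r. r \<in> R \<Longrightarrow> r \<in> words X \<Longrightarrow> word_value f r = \<one>"
  obtains \<phi> where "\<phi> \<in> hom (presented_group X R) G"
    "\<And>x. x \<in> X \<Longrightarrow> \<phi> (pres_class X R [(x, True)]) = f x"
proof -
  define \<phi> where "\<phi> C = word_value f (SOME w. w \<in> C)" for C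
  have \<phi>: "\<phi> (pres_class X R w) = word_value f w" if "w \<in> words X" for w
  proof -
    have "w \<in> pres_class X R w" using that by (simp add: pres_class_def pres_eq.refl)
    then have "(SOME v. v \<in> pres_class X R w) \<in> pres_class X R w" by (metis someI)
    then show ?thesis
      using word_value_pres_eq[OF f R] unfolding \<phi>_def pres_class_def by (metis mem_Collect_eq)
  qed
  have "\<phi> \<in> hom (presented_group X R) G"
  proof (rule homI)
    fix A B assume "A \<in> carrier (presented_group X R)" "B \<in> carrier (presented_group X R)"
    then obtain v w where vw: "v \<in> words X" "w \<in> words X" "A = pres_class X R v" "B = pres_class X R w"
      by (auto simp: presented_group_def)
    show "\<phi> A \<in> carrier G" using vw word_value_closed[OF f] by (simp add: \<phi>)
    have "v @ w \<in> words X" using vw by (simp add: words_def)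
    then show "\<phi> (A \<otimes>\<^bsub>presented_group X R\<^esub> B) = \<phi> A \<otimes> \<phi> B"
      using vw by (simp add: presented_group_mult \<phi> word_value_append[OF f])
  qed
  moreover have "\<phi> (pres_class X R [(x, True)]) = f x" if "x \<in> X" for x
    using that f by (subst \<phi>) (auto simp: words_def Pi_iff)
  ultimately show thesis by (rule that)
qed

lemma hom_generate_eq:
  assumes "h \<in> hom G H" "k \<in> hom G H" "group H" "A \<subseteq> carrier G" "\<And>a. a \<in> A \<Longrightarrow> h a = k a"
    and "x \<in> generate G A"
  shows "h x = k x"
proof -
  interpret h: group_hom G H h using assms(1,3) by (simp add: group_hom_def group_hom_axioms_def)
  interpret k: group_hom G H k using assms(2,3) by (simp add: group_hom_def group_hom_axioms_def)
  show ?thesis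
    using assms(6)
  proof (induction rule: generate.induct)
    case (inv a)
    then have "a \<in> carrier G" using assms(4) by blast
    then show ?case using inv assms(5) by simp
  next
    case (eng a b)
    then show ?case using generate_in_carrier[OF assms(4)] by simp
  qed (use assms(5) in auto)
qed

end

lemma pres_class_inverse:
  assumes "x \<in> X"
  shows "pres_class X R [(x, False)] = inv\<^bsub>presented_group X R\<^esub> pres_class X R [(x, True)]"
proof -
  let ?G = "presented_group X R"
  interpret group ?G by (rule group_presented_group)
  have xb: "[(x, b)] \<in> words X" for b using assms by (simp add: words_def)
  have "pres_eq X R [(x, False), (x, True)] []"
    using pres_eq.cancel[of "[]" X "[]" x R False] assms by (simp add: words_def)
  then have "pres_class X R [(x, False)] \<otimes>\<^bsub>?G\<^esub> pres_class X R [(x, True)] = \<one>\<^bsub>?G\<^esub>"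
    using presented_group_mult[OF xb xb, of R False True] pres_class_eqI
    by (fastforce simp: presented_group_def)
  then show ?thesis
    using xb by (intro inv_equality[symmetric]) (auto simp: presented_group_def)
qed

lemma generate_presented_group:
  "generate (presented_group X R) ((\<lambda>x. pres_class X R [(x, True)]) ` X) = carrier (presented_group X R)"
    (is "generate ?G ?A = _")
proof -
  interpret group ?G by (rule group_presented_group)
  have A: "?A \<subseteq> carrier ?G" by (auto simp: presented_group_def words_def)
  have "pres_class X R w \<in> generate ?G ?A" if "w \<in> words X" for w
    using that
  proof (induction w)
    case Nil
    have "pres_class X R [] = \<one>\<^bsub>?G\<^esub>" by (simp add: presented_group_def)
    then show ?case using generate.one by metis
  next
    case (Cons l w)
    obtain x b where l: "l = (x, b)" by (cases l)
    have x: "x \<in> X" and w: "w \<in> words X" and xb: "\<And>b. [(x, b)] \<in> words X"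
      using Cons.prems l by (auto simp: words_def)
    have "pres_class X R [(x, b)] \<in> generate ?G ?A"
    proof (cases b)
      case True
      then show ?thesis using x by (auto intro: generate.incl)
    next
      case False
      then show ?thesis
        using x pres_class_inverse[OF x] generate.inv[of "pres_class X R [(x, True)]" ?A ?G] by simp
    qed
    moreover have "pres_class X R (l # w) = pres_class X R [(x, b)] \<otimes>\<^bsub>?G\<^esub> pres_class X R w"
      using presented_group_mult[OF xb w] l by simp
    ultimately show ?case using Cons.IH[OF w] generate.eng by metis
  qed
  then show ?thesis
    using generate_incl[OF A] by (auto simp: presented_group_def)
qed

text \<open>Lets a relator be read as an equation between generators inside the presented
  group.\<close>

lemma pres_class_conv_word_value:
  assumes "w \<in> words X"
  shows "pres_class X R w = group.word_value (presented_group X R) (\<lambda>x. pres_class X R [(x, True)]) w"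
proof -
  let ?G = "presented_group X R"
  interpret group ?G by (rule group_presented_group)
  show ?thesis
    using assms
  proof (induction w)
    case Nil
    have "pres_class X R [] = \<one>\<^bsub>?G\<^esub>" by (simp add: presented_group_def)
    then show ?case by simp
  next
    case (Cons l w)
    obtain x b where l: "l = (x, b)" by (cases l)
    have x: "x \<in> X" and w: "w \<in> words X" and xb: "\<And>b. [(x, b)] \<in> words X"
      using Cons.prems l by (auto simp: words_def)
    have "pres_class X R (l # w) = pres_class X R [(x, b)] \<otimes>\<^bsub>?G\<^esub> pres_class X R w"
      using presented_group_mult[OF xb w] l by simp
    then show ?case using Cons.IH[OF w] l pres_class_inverse[OF x] by simp
  qed
qed

lemma pres_class_relator:
  assumes "r \<in> R" "r \<in> words X"
  shows "pres_class X R r = \<one>\<^bsub>presented_group X R\<^esub>"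
  using pres_class_eqI[OF pres_eq.relator[of "[]" X "[]" r R]] assms
  by (simp add: presented_group_def words_def)

section \<open>Groups acting on Boolean groups of sets\<close>

text \<open>The sets of edges form an elementary abelian 2-group under symmetric difference. A
  homomorphism from the group into this semidirect product whose second component is the identity is
  the same as a crossed homomorphism, and in this form it can be defined on generators.\<close>

definition set_semidirect :: "('a, 'c) monoid_scheme \<Rightarrow> 'b set \<Rightarrow> ('a \<Rightarrow> 'b \<Rightarrow> 'b) \<Rightarrow> ('b set \<times> 'a) monoid" where
  "set_semidirect G E act =
    \<lparr>carrier = Pow E \<times> carrier G,
     monoid.mult = (\<lambda>(A, g) (B, h). (A \<triangle> act g ` B, g \<otimes>\<^bsub>G\<^esub> h)),
     one = ({}, \<one>\<^bsub>G\<^esub>)\<rparr>"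

locale group_acting = group +
  fixes E :: "'c set" and act :: "'a \<Rightarrow> 'c \<Rightarrow> 'c"
  assumes act_closed: "g \<in> carrier G \<Longrightarrow> e \<in> E \<Longrightarrow> act g e \<in> E"
    and act_one: "e \<in> E \<Longrightarrow> act \<one> e = e"
    and act_mult: "\<lbrakk>g \<in> carrier G; h \<in> carrier G; e \<in> E\<rbrakk> \<Longrightarrow> act (g \<otimes> h) e = act g (act h e)"
begin

lemma act_inj: "g \<in> carrier G \<Longrightarrow> inj_on (act g) E"
  by (rule inj_on_inverseI[of _ "act (inv g)"]) (simp add: act_mult[symmetric] act_one)

lemma act_image_closed: "g \<in> carrier G \<Longrightarrow> A \<subseteq> E \<Longrightarrow> act g ` A \<subseteq> E"
  using act_closed by blast

lemma act_image_one: "A \<subseteq> E \<Longrightarrow> act \<one> ` A = A"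
  using act_one by (force simp: image_iff)

lemma act_image_mult:
  "\<lbrakk>g \<in> carrier G; h \<in> carrier G; A \<subseteq> E\<rbrakk> \<Longrightarrow> act (g \<otimes> h) ` A = act g ` act h ` A"
  using act_mult by (force simp: image_iff)

lemma act_image_symdiff:
  "\<lbrakk>g \<in> carrier G; A \<subseteq> E; B \<subseteq> E\<rbrakk> \<Longrightarrow> act g ` (A \<triangle> B) = act g ` A \<triangle> act g ` B"
  by (rule image_symdiff[OF act_inj])

lemma group_set_semidirect: "group (set_semidirect G E act)"
proof (rule groupI)
  fix x assume x: "x \<in> carrier (set_semidirect G E act)"
  then obtain A g where [simp]: "x = (A, g)" and A: "A \<subseteq> E" "g \<in> carrier G"
    by (auto simp: set_semidirect_def)
  \<comment> \<open>Every set is its own inverse, so the inverse of \<open>(A, g)\<close> needs only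
    the translate of \<open>A\<close> by \<open>inv g\<close>.\<close>
  have "act (inv g) ` A \<subseteq> E" using A by (intro act_image_closed) auto
  then show "\<exists>y\<in>carrier (set_semidirect G E act). y \<otimes>\<^bsub>set_semidirect G E act\<^esub> x = \<one>\<^bsub>set_semidirect G E act\<^esub>"
    using A by (intro bexI[of _ "(act (inv g) ` A, inv g)"]) (auto simp: set_semidirect_def)
  show "\<one>\<^bsub>set_semidirect G E act\<^esub> \<otimes>\<^bsub>set_semidirect G E act\<^esub> x = x"
    using A by (simp add: set_semidirect_def act_image_one)
  fix y assume "y \<in> carrier (set_semidirect G E act)"
  then obtain B h where [simp]: "y = (B, h)" and B: "B \<subseteq> E" "h \<in> carrier G"
    by (auto simp: set_semidirect_def)
  show "x \<otimes>\<^bsub>set_semidirect G E act\<^esub> y \<in> carrier (set_semidirect G E act)"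
    using A B symdiff_subset[OF A(1) act_image_closed[OF A(2) B(1)]] by (simp add: set_semidirect_def)
  fix z assume "z \<in> carrier (set_semidirect G E act)"
  then obtain C k where [simp]: "z = (C, k)" and C: "C \<subseteq> E" "k \<in> carrier G"
    by (auto simp: set_semidirect_def)
  show "x \<otimes>\<^bsub>set_semidirect G E act\<^esub> y \<otimes>\<^bsub>set_semidirect G E act\<^esub> z =
      x \<otimes>\<^bsub>set_semidirect G E act\<^esub> (y \<otimes>\<^bsub>set_semidirect G E act\<^esub> z)"
    using A B C act_image_closed[OF B(2) C(1)]
    by (simp add: set_semidirect_def act_image_mult act_image_symdiff symdiff_assoc m_assoc)
qed (simp add: set_semidirect_def)

end

section \<open>The Bass--Serre tree\<close>

text \<open>Used with \<open>K\<close> an edge group or its image under an edge map: multiplying by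
  the vertex group turns a coset of the former into one of the latter.\<close>

lemma (in group) set_mult_subgroup_absorb:
  assumes "subgroup H G" "K \<subseteq> H" "K \<noteq> {}"
  shows "K <#> H = H"
proof
  show "K <#> H \<subseteq> H"
    using assms by (auto simp: set_mult_def subgroup.m_closed subsetD)
  obtain k where k: "k \<in> K" using assms(3) by blast
  show "H \<subseteq> K <#> H"
  proof
    fix h assume h: "h \<in> H"
    have c: "k \<in> carrier G" "h \<in> carrier G" using k h assms(1,2) subgroup.subset by blast+
    have "inv k \<otimes> h \<in> H"
      using k h assms(1,2) by (meson subgroup.m_closed subgroup.m_inv_closed subsetD)
    moreover have "h = k \<otimes> (inv k \<otimes> h)" using c by (simp add: m_assoc[symmetric])
    ultimately show "h \<in> K <#> H" using k unfolding set_mult_def by blast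
  qed
qed

lemma (in group) lcos_subgroup_absorb:
  assumes "subgroup H G" "g \<in> carrier G" "h \<in> H"
  shows "(g \<otimes> h) <#\<^bsub>G\<^esub> H = g <#\<^bsub>G\<^esub> H"
  using assms lcos_m_assoc[of H g h] coset_join3[of h H] by (simp add: subgroup.subset subgroup.mem_carrier)

lemma (in group) lcos_eqD:
  assumes "subgroup H G" "g \<in> carrier G" "h \<in> g <#\<^bsub>G\<^esub> H"
  obtains k where "k \<in> H" "h = g \<otimes> k"
  using assms by (auto simp: l_coset_def)

lemma (in group) lcos_self: "subgroup H G \<Longrightarrow> g \<in> carrier G \<Longrightarrow> g \<in> g <#\<^bsub>G\<^esub> H"
  using subgroup.one_closed[of H G] by (force simp: l_coset_def)

text \<open>Setwise products in \<open>tail\<close> and \<open>head\<close> avoid choosing coset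
  representatives. The first components keep apart cosets that belong to different vertices or edges
  of the graph but coincide as sets.\<close>

definition bass_serre_graph ::
  "('v, 'e, 'a) graph_of_groups \<Rightarrow> ('v, 'e) pre_digraph \<Rightarrow>
    ('v \<times> ('v, 'e, 'a) pi1_elt set, 'e \<times> ('v, 'e, 'a) pi1_elt set) pre_digraph"
where
  "bass_serre_graph \<Lambda> T =
    \<lparr>verts = {(v, g <#\<^bsub>pi1 \<Lambda> T\<^esub> vertex_subgroup \<Lambda> T v) | v g.
       v \<in> verts (gog_graph \<Lambda>) \<and> g \<in> carrier (pi1 \<Lambda> T)},
     arcs = {(e, g <#\<^bsub>pi1 \<Lambda> T\<^esub> edge_subgroup \<Lambda> T e) | e g.
       e \<in> arcs (gog_graph \<Lambda>) \<and> g \<in> carrier (pi1 \<Lambda> T)},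
     tail = (\<lambda>(e, C). (tail (gog_graph \<Lambda>) e,
       C <#>\<^bsub>pi1 \<Lambda> T\<^esub> vertex_subgroup \<Lambda> T (tail (gog_graph \<Lambda>) e))),
     head = (\<lambda>(e, C). (head (gog_graph \<Lambda>) e,
       C #>\<^bsub>pi1 \<Lambda> T\<^esub> pi1_stable \<Lambda> T e <#>\<^bsub>pi1 \<Lambda> T\<^esub> vertex_subgroup \<Lambda> T (head (gog_graph \<Lambda>) e)))\<rparr>"

definition translate :: "('a, 'c) monoid_scheme \<Rightarrow> 'a \<Rightarrow> 'i \<times> 'a set \<Rightarrow> 'i \<times> 'a set" where
  "translate G g = map_prod id (\<lambda>C. g <#\<^bsub>G\<^esub> C)"

lemma translate_simp [simp]: "translate G g (i, C) = (i, g <#\<^bsub>G\<^esub> C)"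
  by (simp add: translate_def)

locale graph_of_groups_pi1 =
  fixes \<Lambda> :: "('v, 'e, 'a) graph_of_groups" and T :: "('v, 'e) pre_digraph"
  assumes gog: "is_graph_of_groups \<Lambda>"
    and spanning_tree: "unoriented_spanning_tree T (gog_graph \<Lambda>)"
begin

abbreviation "\<Gamma> \<equiv> gog_graph \<Lambda>"
abbreviation "\<pi> \<equiv> pi1 \<Lambda> T"
abbreviation "\<G> \<equiv> vertex_subgroup \<Lambda> T"
abbreviation "\<E> \<equiv> edge_subgroup \<Lambda> T"
abbreviation "\<tau> \<equiv> pi1_stable \<Lambda> T"
abbreviation "\<X> \<equiv> bass_serre_graph \<Lambda> T"

sublocale graph: wf_digraph \<Gamma>
  using gog by (simp add: is_graph_of_groups_def)

sublocale pi: group \<pi>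
  unfolding pi1_def by (rule group_presented_group)

lemma tree_wf: "wf_digraph T" and tree: "unoriented_tree T"
  and tree_verts: "verts T = verts \<Gamma>" and tree_arcs: "arcs T \<subseteq> arcs \<Gamma>"
  and tree_ends: "tail T = tail \<Gamma>" "head T = head \<Gamma>"
  using spanning_tree
  by (auto simp: unoriented_spanning_tree_def spanning_def subgraph_def compatible_def)

lemma tree_connected: "Digraph_Component.connected T"
  using tree by (simp add: unoriented_tree_def)

lemma vertex_group: "v \<in> verts \<Gamma> \<Longrightarrow> group (vertex_group \<Lambda> v)"
  using gog by (simp add: is_graph_of_groups_def)

lemma edge_group: "e \<in> arcs \<Gamma> \<Longrightarrow> subgroup (edge_group \<Lambda> e) (vertex_group \<Lambda> (tail \<Gamma> e))"
  using gog by (simp add: is_graph_of_groups_def)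

lemma edge_group_carrier:
  "e \<in> arcs \<Gamma> \<Longrightarrow> x \<in> edge_group \<Lambda> e \<Longrightarrow> x \<in> carrier (vertex_group \<Lambda> (tail \<Gamma> e))"
  using edge_group subgroup.mem_carrier by metis

lemma edge_map_carrier:
  assumes "e \<in> arcs \<Gamma>" "x \<in> edge_group \<Lambda> e"
  shows "edge_map \<Lambda> e x \<in> carrier (vertex_group \<Lambda> (head \<Gamma> e))"
  using gog assms by (auto simp: is_graph_of_groups_def mon_def hom_def)

section \<open>Generators and relations of the fundamental group\<close>

abbreviation "gens \<equiv> gog_gens \<Lambda>"
abbreviation "rels \<equiv> gog_relators \<Lambda> T"

definition gen :: "('v, 'e, 'a) gog_gen \<Rightarrow> ('v, 'e, 'a) pi1_elt" where
  "gen x = pres_class gens rels [(x, True)]"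

lemma gen_closed: "x \<in> gens \<Longrightarrow> gen x \<in> carrier \<pi>"
  by (auto simp: gen_def pi1_def presented_group_def words_def)

lemma gen_simps: "gen (VGen v g) = pi1_vertex \<Lambda> T v g" "gen (Stable e) = \<tau> e"
  by (simp_all add: gen_def pi1_vertex_def pi1_stable_def)

lemma VGen_gens: "v \<in> verts \<Gamma> \<Longrightarrow> g \<in> carrier (vertex_group \<Lambda> v) \<Longrightarrow> VGen v g \<in> gens"
  by (simp add: gog_gens_def)

lemma Stable_gens: "e \<in> arcs \<Gamma> \<Longrightarrow> Stable e \<in> gens"
  by (simp add: gog_gens_def)

lemma pi1_vertex_closed:
  "v \<in> verts \<Gamma> \<Longrightarrow> g \<in> carrier (vertex_group \<Lambda> v) \<Longrightarrow> pi1_vertex \<Lambda> T v g \<in> carrier \<pi>"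
  using gen_closed VGen_gens by (metis gen_simps(1))

lemma stable_closed: "e \<in> arcs \<Gamma> \<Longrightarrow> \<tau> e \<in> carrier \<pi>"
  using gen_closed Stable_gens by (metis gen_simps(2))

lemma gen_relator:
  assumes "r \<in> rels" "r \<in> words gens"
  shows "pi.word_value gen r = \<one>\<^bsub>\<pi>\<^esub>"
  using pres_class_relator[OF assms] pres_class_conv_word_value[OF assms(2), of rels]
  by (simp add: gen_def[abs_def] pi1_def)

lemma generate_gens: "generate \<pi> (gen ` gens) = carrier \<pi>"
  unfolding gen_def[abs_def] pi1_def by (rule generate_presented_group)

lemma vertex_relator:
  assumes "v \<in> verts \<Gamma>" "g \<in> carrier (vertex_group \<Lambda> v)" "h \<in> carrier (vertex_group \<Lambda> v)"
  shows "[(VGen v g, True), (VGen v h, True), (VGen v (g \<otimes>\<^bsub>vertex_group \<Lambda> v\<^esub> h), False)] \<in> rels \<inter> words gens"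
  using assms vertex_group[OF assms(1)]
  by (auto simp: gog_relators_def words_def gog_gens_def group.is_monoid monoid.m_closed)

lemma edge_relator:
  assumes "e \<in> arcs \<Gamma>" "g \<in> edge_group \<Lambda> e"
  shows "[(VGen (tail \<Gamma> e) g, True), (Stable e, True),
      (VGen (head \<Gamma> e) (edge_map \<Lambda> e g), False), (Stable e, False)] \<in> rels \<inter> words gens"
  using assms edge_group_carrier[OF assms] edge_map_carrier[OF assms]
  by (auto simp: gog_relators_def words_def gog_gens_def)

lemma pi1_vertex_hom:
  assumes v: "v \<in> verts \<Gamma>"
  shows "pi1_vertex \<Lambda> T v \<in> hom (vertex_group \<Lambda> v) \<pi>"
proof (rule homI)
  show "pi1_vertex \<Lambda> T v g \<in> carrier \<pi>" if "g \<in> carrier (vertex_group \<Lambda> v)" for g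
    using pi1_vertex_closed v that .
  fix g h assume gh: "g \<in> carrier (vertex_group \<Lambda> v)" "h \<in> carrier (vertex_group \<Lambda> v)"
  then have c: "g \<otimes>\<^bsub>vertex_group \<Lambda> v\<^esub> h \<in> carrier (vertex_group \<Lambda> v)"
    using vertex_group[OF v] by (simp add: group.is_monoid monoid.m_closed)
  note cl = pi1_vertex_closed[OF v gh(1)] pi1_vertex_closed[OF v gh(2)] pi1_vertex_closed[OF v c]
  have "pi1_vertex \<Lambda> T v g \<otimes>\<^bsub>\<pi>\<^esub> (pi1_vertex \<Lambda> T v h \<otimes>\<^bsub>\<pi>\<^esub> inv\<^bsub>\<pi>\<^esub> pi1_vertex \<Lambda> T v (g \<otimes>\<^bsub>vertex_group \<Lambda> v\<^esub> h)) = \<one>\<^bsub>\<pi>\<^esub>"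
    using gen_relator vertex_relator[OF v gh] cl by (fastforce simp: gen_simps)
  then show "pi1_vertex \<Lambda> T v (g \<otimes>\<^bsub>vertex_group \<Lambda> v\<^esub> h) = pi1_vertex \<Lambda> T v g \<otimes>\<^bsub>\<pi>\<^esub> pi1_vertex \<Lambda> T v h"
    using cl by (metis pi.inv_closed pi.inv_equality pi.inv_inv pi.m_assoc pi.m_closed)
qed

lemma vertex_subgroup: "v \<in> verts \<Gamma> \<Longrightarrow> subgroup (\<G> v) \<pi>"
  unfolding vertex_subgroup_def
  using group_hom.img_is_subgroup[of "vertex_group \<Lambda> v" \<pi> "pi1_vertex \<Lambda> T v"]
    pi1_vertex_hom vertex_group by (simp add: group_hom_def group_hom_axioms_def)

lemma edge_subgroup: "e \<in> arcs \<Gamma> \<Longrightarrow> subgroup (\<E> e) \<pi>"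
  unfolding edge_subgroup_def
  using group_hom.subgroup_img_is_subgroup[of "vertex_group \<Lambda> (tail \<Gamma> e)" \<pi> "pi1_vertex \<Lambda> T (tail \<Gamma> e)"]
    pi1_vertex_hom vertex_group edge_group by (simp add: group_hom_def group_hom_axioms_def)

lemma edge_subgroup_subset: "e \<in> arcs \<Gamma> \<Longrightarrow> \<E> e \<subseteq> \<G> (tail \<Gamma> e)"
  unfolding edge_subgroup_def vertex_subgroup_def using edge_group_carrier by blast

lemma stable_commute:
  assumes "e \<in> arcs \<Gamma>" "g \<in> edge_group \<Lambda> e"
  shows "pi1_vertex \<Lambda> T (tail \<Gamma> e) g \<otimes>\<^bsub>\<pi>\<^esub> \<tau> e =
    \<tau> e \<otimes>\<^bsub>\<pi>\<^esub> pi1_vertex \<Lambda> T (head \<Gamma> e) (edge_map \<Lambda> e g)"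
proof -
  note cl = pi1_vertex_closed[OF graph.tail_in_verts[OF assms(1)] edge_group_carrier[OF assms]]
    pi1_vertex_closed[OF graph.head_in_verts[OF assms(1)] edge_map_carrier[OF assms]] stable_closed[OF assms(1)]
  have "pi1_vertex \<Lambda> T (tail \<Gamma> e) g \<otimes>\<^bsub>\<pi>\<^esub> (\<tau> e \<otimes>\<^bsub>\<pi>\<^esub>
      (inv\<^bsub>\<pi>\<^esub> pi1_vertex \<Lambda> T (head \<Gamma> e) (edge_map \<Lambda> e g) \<otimes>\<^bsub>\<pi>\<^esub> inv\<^bsub>\<pi>\<^esub> \<tau> e)) = \<one>\<^bsub>\<pi>\<^esub>"
    using gen_relator edge_relator[OF assms] cl by (fastforce simp: gen_simps)
  then have "(pi1_vertex \<Lambda> T (tail \<Gamma> e) g \<otimes>\<^bsub>\<pi>\<^esub> \<tau> e) \<otimes>\<^bsub>\<pi>\<^esub>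
      inv\<^bsub>\<pi>\<^esub> (\<tau> e \<otimes>\<^bsub>\<pi>\<^esub> pi1_vertex \<Lambda> T (head \<Gamma> e) (edge_map \<Lambda> e g)) = \<one>\<^bsub>\<pi>\<^esub>"
    using cl by (simp add: pi.inv_mult_group pi.m_assoc)
  then show ?thesis
    using cl by (metis pi.inv_closed pi.inv_equality pi.inv_inv pi.m_closed)
qed

lemma stable_tree:
  assumes "e \<in> arcs T"
  shows "\<tau> e = \<one>\<^bsub>\<pi>\<^esub>"
proof -
  have "[(Stable e, True)] \<in> rels" "[(Stable e, True)] \<in> words gens"
    using assms tree_arcs by (auto simp: gog_relators_def words_def gog_gens_def)
  from gen_relator[OF this] show ?thesis
    using stable_closed[of e] assms tree_arcs by (auto simp: gen_simps)
qed

lemma coset_carrier: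
  "v \<in> verts \<Gamma> \<Longrightarrow> \<G> v \<subseteq> carrier \<pi>" "e \<in> arcs \<Gamma> \<Longrightarrow> \<E> e \<subseteq> carrier \<pi>"
  using vertex_subgroup edge_subgroup subgroup.subset by blast+

section \<open>The coset graph and the action by translation\<close>

lemma verts_X: "verts \<X> = {(v, g <#\<^bsub>\<pi>\<^esub> \<G> v) | v g. v \<in> verts \<Gamma> \<and> g \<in> carrier \<pi>}"
  and arcs_X: "arcs \<X> = {(e, g <#\<^bsub>\<pi>\<^esub> \<E> e) | e g. e \<in> arcs \<Gamma> \<and> g \<in> carrier \<pi>}"
  by (simp_all add: bass_serre_graph_def)

lemma vert_XI: "v \<in> verts \<Gamma> \<Longrightarrow> g \<in> carrier \<pi> \<Longrightarrow> (v, g <#\<^bsub>\<pi>\<^esub> \<G> v) \<in> verts \<X>"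
  and arc_XI: "e \<in> arcs \<Gamma> \<Longrightarrow> g \<in> carrier \<pi> \<Longrightarrow> (e, g <#\<^bsub>\<pi>\<^esub> \<E> e) \<in> arcs \<X>"
  unfolding verts_X arcs_X by blast+

lemma tail_X:
  assumes "e \<in> arcs \<Gamma>" "g \<in> carrier \<pi>"
  shows "tail \<X> (e, g <#\<^bsub>\<pi>\<^esub> \<E> e) = (tail \<Gamma> e, g <#\<^bsub>\<pi>\<^esub> \<G> (tail \<Gamma> e))"
proof -
  have "\<E> e <#>\<^bsub>\<pi>\<^esub> \<G> (tail \<Gamma> e) = \<G> (tail \<Gamma> e)"
    using pi.set_mult_subgroup_absorb[OF vertex_subgroup[OF graph.tail_in_verts] edge_subgroup_subset]
      subgroup.one_closed[OF edge_subgroup] assms(1) by blast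
  then have "(g <#\<^bsub>\<pi>\<^esub> \<E> e) <#>\<^bsub>\<pi>\<^esub> \<G> (tail \<Gamma> e) = g <#\<^bsub>\<pi>\<^esub> \<G> (tail \<Gamma> e)"
    using assms coset_carrier pi.set_mult_assoc[of "{g}" "\<E> e" "\<G> (tail \<Gamma> e)"]
    by (simp add: l_coset_eq_set_mult)
  then show ?thesis by (simp add: bass_serre_graph_def)
qed

text \<open>The edge relators move the stable letter to the left: \<open>\<E> e\<close> times
  \<open>\<tau> e\<close> is \<open>\<tau> e\<close> times the image \<open>?F\<close> of the edge
  map, and \<open>?F\<close> is absorbed by the vertex group at the head.\<close>

lemma head_X:
  assumes "e \<in> arcs \<Gamma>" "g \<in> carrier \<pi>"
  shows "head \<X> (e, g <#\<^bsub>\<pi>\<^esub> \<E> e) = (head \<Gamma> e, (g \<otimes>\<^bsub>\<pi>\<^esub> \<tau> e) <#\<^bsub>\<pi>\<^esub> \<G> (head \<Gamma> e))"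
proof -
  let ?t = "\<tau> e" and ?H = "\<G> (head \<Gamma> e)"
  let ?F = "pi1_vertex \<Lambda> T (head \<Gamma> e) ` edge_map \<Lambda> e ` edge_group \<Lambda> e"
  have t: "?t \<in> carrier \<pi>" using assms stable_closed by blast
  have F: "?F \<subseteq> ?H" unfolding vertex_subgroup_def using edge_map_carrier assms(1) by blast
  have "?F \<noteq> {}" using subgroup.one_closed[OF edge_group[OF assms(1)]] by blast
  then have FH: "?F <#>\<^bsub>\<pi>\<^esub> ?H = ?H"
    using pi.set_mult_subgroup_absorb[OF vertex_subgroup F] assms by simp
  have c: "?H \<subseteq> carrier \<pi>" "\<E> e \<subseteq> carrier \<pi>" "?F \<subseteq> carrier \<pi>"
    using coset_carrier(1)[OF graph.head_in_verts[OF assms(1)]] coset_carrier(2)[OF assms(1)] F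
    by blast+
  have "\<E> e #>\<^bsub>\<pi>\<^esub> ?t = ?t <#\<^bsub>\<pi>\<^esub> ?F"
    unfolding edge_subgroup_def r_coset_def l_coset_def using stable_commute[OF assms(1)] by auto
  then have "(\<E> e #>\<^bsub>\<pi>\<^esub> ?t) <#>\<^bsub>\<pi>\<^esub> ?H = ?t <#\<^bsub>\<pi>\<^esub> ?H"
    using t c pi.set_mult_assoc[of "{?t}" ?F ?H] FH by (simp add: l_coset_eq_set_mult)
  moreover have "(g <#\<^bsub>\<pi>\<^esub> \<E> e) #>\<^bsub>\<pi>\<^esub> ?t <#>\<^bsub>\<pi>\<^esub> ?H = g <#\<^bsub>\<pi>\<^esub> ((\<E> e #>\<^bsub>\<pi>\<^esub> ?t) <#>\<^bsub>\<pi>\<^esub> ?H)"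
    using t c assms pi.set_mult_assoc[of "{g}" "\<E> e" "{?t}"]
      pi.set_mult_assoc[of "{g}" "\<E> e <#>\<^bsub>\<pi>\<^esub> {?t}" ?H] pi.set_mult_closed[of "\<E> e" "{?t}"]
    by (simp add: l_coset_eq_set_mult r_coset_eq_set_mult)
  ultimately show ?thesis
    using t c assms by (simp add: bass_serre_graph_def pi.lcos_m_assoc)
qed

lemma wf_X: "wf_digraph \<X>"
proof
  fix \<epsilon> assume "\<epsilon> \<in> arcs \<X>"
  then obtain e g where e: "e \<in> arcs \<Gamma>" "g \<in> carrier \<pi>" "\<epsilon> = (e, g <#\<^bsub>\<pi>\<^esub> \<E> e)"
    by (auto simp: arcs_X)
  show "tail \<X> \<epsilon> \<in> verts \<X>" "head \<X> \<epsilon> \<in> verts \<X>"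
    using e by (simp_all add: tail_X head_X vert_XI stable_closed)
qed

lemma translate_vert: "v \<in> verts \<Gamma> \<Longrightarrow> g \<in> carrier \<pi> \<Longrightarrow> h \<in> carrier \<pi> \<Longrightarrow>
    translate \<pi> h (v, g <#\<^bsub>\<pi>\<^esub> \<G> v) = (v, (h \<otimes>\<^bsub>\<pi>\<^esub> g) <#\<^bsub>\<pi>\<^esub> \<G> v)"
  and translate_arc: "e \<in> arcs \<Gamma> \<Longrightarrow> g \<in> carrier \<pi> \<Longrightarrow> h \<in> carrier \<pi> \<Longrightarrow>
    translate \<pi> h (e, g <#\<^bsub>\<pi>\<^esub> \<E> e) = (e, (h \<otimes>\<^bsub>\<pi>\<^esub> g) <#\<^bsub>\<pi>\<^esub> \<E> e)"
  using coset_carrier by (simp_all add: pi.lcos_m_assoc)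

lemma group_acting_verts: "group_acting \<pi> (verts \<X>) (translate \<pi>)"
proof
  fix g h x assume g: "g \<in> carrier \<pi>" and x: "x \<in> verts \<X>"
  then obtain v k where v: "v \<in> verts \<Gamma>" "k \<in> carrier \<pi>" "x = (v, k <#\<^bsub>\<pi>\<^esub> \<G> v)"
    by (auto simp: verts_X)
  show "translate \<pi> g x \<in> verts \<X>" using v g by (simp add: translate_vert vert_XI del: translate_simp)
  assume h: "h \<in> carrier \<pi>"
  show "translate \<pi> (g \<otimes>\<^bsub>\<pi>\<^esub> h) x = translate \<pi> g (translate \<pi> h x)"
    using v g h by (simp add: translate_vert pi.m_assoc del: translate_simp)
next
  fix x assume "x \<in> verts \<X>"
  then show "translate \<pi> \<one>\<^bsub>\<pi>\<^esub> x = x" by (auto simp: verts_X translate_vert simp del: translate_simp)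
qed

sublocale arcs_action: group_acting \<pi> "arcs \<X>" "translate \<pi>"
proof
  fix g h x assume g: "g \<in> carrier \<pi>" and x: "x \<in> arcs \<X>"
  then obtain v k where v: "v \<in> arcs \<Gamma>" "k \<in> carrier \<pi>" "x = (v, k <#\<^bsub>\<pi>\<^esub> \<E> v)"
    by (auto simp: arcs_X)
  show "translate \<pi> g x \<in> arcs \<X>" using v g by (simp add: translate_arc arc_XI del: translate_simp)
  assume h: "h \<in> carrier \<pi>"
  show "translate \<pi> (g \<otimes>\<^bsub>\<pi>\<^esub> h) x = translate \<pi> g (translate \<pi> h x)"
    using v g h by (simp add: translate_arc pi.m_assoc del: translate_simp)
next
  fix x assume "x \<in> arcs \<X>"
  then show "translate \<pi> \<one>\<^bsub>\<pi>\<^esub> x = x" by (auto simp: arcs_X translate_arc simp del: translate_simp)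
qed

lemma translate_ends:
  assumes "g \<in> carrier \<pi>" "\<epsilon> \<in> arcs \<X>"
  shows "tail \<X> (translate \<pi> g \<epsilon>) = translate \<pi> g (tail \<X> \<epsilon>)"
    "head \<X> (translate \<pi> g \<epsilon>) = translate \<pi> g (head \<X> \<epsilon>)"
proof -
  obtain e k where e: "e \<in> arcs \<Gamma>" "k \<in> carrier \<pi>" "\<epsilon> = (e, k <#\<^bsub>\<pi>\<^esub> \<E> e)"
    using assms(2) by (auto simp: arcs_X)
  note t = stable_closed[OF e(1)]
  show "tail \<X> (translate \<pi> g \<epsilon>) = translate \<pi> g (tail \<X> \<epsilon>)"
    "head \<X> (translate \<pi> g \<epsilon>) = translate \<pi> g (head \<X> \<epsilon>)"
    using assms(1) e t
    by (simp_all add: translate_arc translate_vert tail_X head_X pi.m_assoc del: translate_simp)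
qed

text \<open>Let \<open>Q\<close> be a property shared by the ends of each arc. The translate of the
  base copy of \<open>T\<close> by \<open>g\<close> has trivial stable letters along it, so
  \<open>Q\<close> has one truth value \<open>Q' g\<close> there. Right multiplication of
  \<open>g\<close> by a vertex group element keeps one of these vertices, and multiplication by a
  stable letter crosses one arc. Since these elements generate, \<open>Q'\<close> is
  constant.\<close>

lemma connected_X: "Digraph_Component.connected \<X>"
proof -
  obtain r where r: "r \<in> verts T"
    using tree_connected by (auto simp: connected_def strongly_connected_def mk_symmetric_def)
  show ?thesis
  proof (rule connectedI[OF wf_X])
    show base: "(r, \<one>\<^bsub>\<pi>\<^esub> <#\<^bsub>\<pi>\<^esub> \<G> r) \<in> verts \<X>" using r tree_verts by (simp add: vert_XI)
    fix Q y
    assume Q: "Q (r, \<one>\<^bsub>\<pi>\<^esub> <#\<^bsub>\<pi>\<^esub> \<G> r)" and y: "y \<in> verts \<X>"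
      and step: "\<And>\<epsilon>. \<epsilon> \<in> arcs \<X> \<Longrightarrow> Q (tail \<X> \<epsilon>) \<longleftrightarrow> Q (head \<X> \<epsilon>)"
    have edge: "Q (tail \<Gamma> e, g <#\<^bsub>\<pi>\<^esub> \<G> (tail \<Gamma> e)) \<longleftrightarrow>
        Q (head \<Gamma> e, (g \<otimes>\<^bsub>\<pi>\<^esub> \<tau> e) <#\<^bsub>\<pi>\<^esub> \<G> (head \<Gamma> e))"
      if "e \<in> arcs \<Gamma>" "g \<in> carrier \<pi>" for e g
      using step[OF arc_XI[OF that]] that by (simp add: tail_X head_X)
    define Q' where "Q' g = Q (r, g <#\<^bsub>\<pi>\<^esub> \<G> r)" for g
    have Q': "Q (v, g <#\<^bsub>\<pi>\<^esub> \<G> v) \<longleftrightarrow> Q' g" if "v \<in> verts \<Gamma>" and g: "g \<in> carrier \<pi>" for v g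
    proof (rule connected_induct[OF tree_wf tree_connected r])
      show "v \<in> verts T" using that tree_verts by simp
      show "Q (r, g <#\<^bsub>\<pi>\<^esub> \<G> r) \<longleftrightarrow> Q' g" by (simp add: Q'_def)
      fix e assume "e \<in> arcs T"
      then show "(Q (tail T e, g <#\<^bsub>\<pi>\<^esub> \<G> (tail T e)) \<longleftrightarrow> Q' g) \<longleftrightarrow>
          (Q (head T e, g <#\<^bsub>\<pi>\<^esub> \<G> (head T e)) \<longleftrightarrow> Q' g)"
        using edge[of e g] stable_tree[of e] tree_arcs tree_ends g by auto
    qed
    have invariant_gen: "Q' (g \<otimes>\<^bsub>\<pi>\<^esub> x) \<longleftrightarrow> Q' g" if "x \<in> gen ` gens" and g: "g \<in> carrier \<pi>" for g x
    proof -
      consider v h where "v \<in> verts \<Gamma>" "h \<in> carrier (vertex_group \<Lambda> v)" "x = pi1_vertex \<Lambda> T v h"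
        | e where "e \<in> arcs \<Gamma>" "x = \<tau> e"
        using \<open>x \<in> gen ` gens\<close> by (auto simp: gog_gens_def gen_simps)
      then show ?thesis
      proof cases
        case (1 v h)
        then have x: "x \<in> \<G> v" "x \<in> carrier \<pi>" by (auto simp: vertex_subgroup_def pi1_vertex_closed)
        then show ?thesis
          using Q'[OF 1(1), of g] Q'[OF 1(1), of "g \<otimes>\<^bsub>\<pi>\<^esub> x"]
            pi.lcos_subgroup_absorb[OF vertex_subgroup[OF 1(1)] g x(1)] g by simp
      next
        case (2 e)
        then show ?thesis
          using edge[of e g] Q'[of "tail \<Gamma> e" g] Q'[of "head \<Gamma> e" "g \<otimes>\<^bsub>\<pi>\<^esub> x"] g stable_closed by simp
      qed
    qed
    have "Q' (g \<otimes>\<^bsub>\<pi>\<^esub> x) \<longleftrightarrow> Q' g" if "x \<in> generate \<pi> (gen ` gens)" "g \<in> carrier \<pi>" for g x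
      using that
    proof (induction arbitrary: g rule: generate.induct)
      case (incl x)
      then show ?case using invariant_gen by blast
    next
      case (inv x)
      then have "x \<in> carrier \<pi>" using gen_closed by blast
      then show ?case
        using invariant_gen[OF inv(1), of "g \<otimes>\<^bsub>\<pi>\<^esub> inv\<^bsub>\<pi>\<^esub> x"] inv(2) by (simp add: pi.m_assoc)
    next
      case (eng x x')
      then have "x \<in> carrier \<pi>" "x' \<in> carrier \<pi>" using generate_gens by auto
      then show ?case
        using eng.IH(1)[OF eng.prems] eng.IH(2)[of "g \<otimes>\<^bsub>\<pi>\<^esub> x"] eng.prems by (simp add: pi.m_assoc)
    qed simp
    moreover have "Q' \<one>\<^bsub>\<pi>\<^esub>" using Q by (simp add: Q'_def)
    ultimately have "Q' g" if "g \<in> carrier \<pi>" for g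
      using that generate_gens by (metis pi.l_one pi.one_closed)
    then show "Q y" using y Q' by (auto simp: verts_X)
  qed
qed

end

section \<open>A potential on the coset graph\<close>

context graph_of_groups_pi1
begin

definition base_arc :: "'e \<Rightarrow> 'e \<times> ('v, 'e, 'a) pi1_elt set" where
  "base_arc e = (e, \<E> e)"

lemma base_arc_lcos: "e \<in> arcs \<Gamma> \<Longrightarrow> base_arc e = (e, \<one>\<^bsub>\<pi>\<^esub> <#\<^bsub>\<pi>\<^esub> \<E> e)"
  using coset_carrier by (simp add: base_arc_def pi.lcos_mult_one)

lemma base_arc_X: "e \<in> arcs \<Gamma> \<Longrightarrow> base_arc e \<in> arcs \<X>"
  by (simp add: base_arc_lcos arc_XI)

lemma translate_base_arc:
  "e \<in> arcs \<Gamma> \<Longrightarrow> g \<in> carrier \<pi> \<Longrightarrow> translate \<pi> g (base_arc e) = (e, g <#\<^bsub>\<pi>\<^esub> \<E> e)"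
  by (simp add: base_arc_def)

lemma translate_base_arc_fixed:
  assumes "e \<in> arcs \<Gamma>" "g \<in> \<E> e"
  shows "translate \<pi> g (base_arc e) = base_arc e"
  using assms pi.coset_join3[OF _ edge_subgroup[OF assms(1)] assms(2)] coset_carrier
  by (auto simp: base_arc_def)

text \<open>
  The would-be potential of the translate by \<open>g\<close> of the base vertex of \<open>v\<close> is \<open>c g \<triangle> g p\<^sub>v\<close> for a
  crossed homomorphism \<open>c\<close>. Equivariance dictates the values of \<open>c\<close> on the generators, and von Dyck's
  theorem for the semidirect product shows that they extend to \<open>\<pi>\<close>. This replaces the normal form
  theorem.
\<close>

lemma crossed_homomorphism:
  assumes p: "\<And>v. v \<in> verts \<Gamma> \<Longrightarrow> p v \<subseteq> arcs \<X>"
    and p_tree: "\<And>e. e \<in> arcs T \<Longrightarrow> p (head \<Gamma> e) = p (tail \<Gamma> e) \<triangle> {base_arc e}"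
  obtains c where "\<And>g. g \<in> carrier \<pi> \<Longrightarrow> c g \<subseteq> arcs \<X>"
    "\<And>g h. \<lbrakk>g \<in> carrier \<pi>; h \<in> carrier \<pi>\<rbrakk> \<Longrightarrow> c (g \<otimes>\<^bsub>\<pi>\<^esub> h) = c g \<triangle> translate \<pi> g ` c h"
    "\<And>v g. \<lbrakk>v \<in> verts \<Gamma>; g \<in> \<G> v\<rbrakk> \<Longrightarrow> c g = p v \<triangle> translate \<pi> g ` p v"
    "\<And>e. e \<in> arcs \<Gamma> \<Longrightarrow>
      c (\<tau> e) = p (tail \<Gamma> e) \<triangle> {base_arc e} \<triangle> translate \<pi> (\<tau> e) ` p (head \<Gamma> e)"
proof -
  let ?tr = "\<lambda>g A. translate \<pi> g ` A"
  define D where "D = set_semidirect \<pi> (arcs \<X>) (translate \<pi>)"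
  interpret D: group D
    unfolding D_def by (rule arcs_action.group_set_semidirect)
  have D_carrier: "(A, g) \<in> carrier D \<longleftrightarrow> A \<subseteq> arcs \<X> \<and> g \<in> carrier \<pi>" for A g
    by (simp add: D_def set_semidirect_def)
  have D_mult: "(A, g) \<otimes>\<^bsub>D\<^esub> (B, h) = (A \<triangle> ?tr g B, g \<otimes>\<^bsub>\<pi>\<^esub> h)" for A B g h
    by (simp add: D_def set_semidirect_def)
  have D_one: "\<one>\<^bsub>D\<^esub> = ({}, \<one>\<^bsub>\<pi>\<^esub>)"
    by (simp add: D_def set_semidirect_def)
  \<comment> \<open>The first components solve two equations. The potential \<open>p v\<close> of a
    base vertex must not change under \<open>g\<close> in its stabilizer:
    \<open>c g \<triangle> g (p v) = p v\<close>. Across the base arc it must change by that arc: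
    \<open>c (\<tau> e) \<triangle> \<tau> e (p (head e)) = p (tail e) \<triangle> {base_arc
    e}\<close>.\<close>
  define f where "f x = (case x of
      VGen v g \<Rightarrow> (p v \<triangle> ?tr (pi1_vertex \<Lambda> T v g) (p v), pi1_vertex \<Lambda> T v g)
    | Stable e \<Rightarrow> (p (tail \<Gamma> e) \<triangle> {base_arc e} \<triangle> ?tr (\<tau> e) (p (head \<Gamma> e)), \<tau> e))" for x
  note tr = arcs_action.act_image_closed arcs_action.act_image_mult arcs_action.act_image_symdiff
    arcs_action.act_image_one
  have snd_f: "snd (f x) = gen x" for x
    by (cases x) (simp_all add: f_def gen_simps)
  have f: "f \<in> gens \<rightarrow> carrier D"
  proof
    fix x assume "x \<in> gens"
    then consider v g where "v \<in> verts \<Gamma>" "g \<in> carrier (vertex_group \<Lambda> v)" "x = VGen v g"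
      | e where "e \<in> arcs \<Gamma>" "x = Stable e"
      by (auto simp: gog_gens_def)
    then show "f x \<in> carrier D"
      by cases (simp_all add: f_def D_carrier symdiff_subset p tr pi1_vertex_closed stable_closed base_arc_X)
  qed
  have rel: "D.word_value f r = \<one>\<^bsub>D\<^esub>" if "r \<in> rels" "r \<in> words gens" for r
  proof -
    consider v g h where "v \<in> verts \<Gamma>" "g \<in> carrier (vertex_group \<Lambda> v)" "h \<in> carrier (vertex_group \<Lambda> v)"
        "r = [(VGen v g, True), (VGen v h, True), (VGen v (g \<otimes>\<^bsub>vertex_group \<Lambda> v\<^esub> h), False)]"
      | e g where "e \<in> arcs \<Gamma>" "g \<in> edge_group \<Lambda> e"
        "r = [(VGen (tail \<Gamma> e) g, True), (Stable e, True),
          (VGen (head \<Gamma> e) (edge_map \<Lambda> e g), False), (Stable e, False)]"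
      | e where "e \<in> arcs T" "r = [(Stable e, True)]"
      using \<open>r \<in> rels\<close> unfolding gog_relators_def by blast
    then show ?thesis
    proof cases
      case (1 v g h)
      let ?gh = "g \<otimes>\<^bsub>vertex_group \<Lambda> v\<^esub> h"
      have gh: "?gh \<in> carrier (vertex_group \<Lambda> v)"
        using 1 vertex_group[OF 1(1)] by (simp add: group.is_monoid monoid.m_closed)
      have mult: "pi1_vertex \<Lambda> T v ?gh = pi1_vertex \<Lambda> T v g \<otimes>\<^bsub>\<pi>\<^esub> pi1_vertex \<Lambda> T v h"
        using pi1_vertex_hom[OF 1(1)] 1 by (simp add: hom_mult)
      have eq: "f (VGen v g) \<otimes>\<^bsub>D\<^esub> f (VGen v h) = f (VGen v ?gh)"
        using 1 p[OF 1(1)] by (simp add: f_def D_mult mult tr pi1_vertex_closed symdiff_assoc)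
      have "f (VGen v g) \<in> carrier D" "f (VGen v h) \<in> carrier D" "f (VGen v ?gh) \<in> carrier D"
        using f 1 gh VGen_gens by auto
      then show ?thesis
        using 1(4) eq by (simp add: D.m_assoc[symmetric])
    next
      case (2 e g)
      let ?a = "tail \<Gamma> e" and ?b = "head \<Gamma> e" and ?k = "edge_map \<Lambda> e g"
      have v: "?a \<in> verts \<Gamma>" "?b \<in> verts \<Gamma>" using 2 by auto
      have g: "g \<in> carrier (vertex_group \<Lambda> ?a)" "?k \<in> carrier (vertex_group \<Lambda> ?b)"
        using 2 edge_group_carrier edge_map_carrier by auto
      note c = pi1_vertex_closed[OF v(1) g(1)] pi1_vertex_closed[OF v(2) g(2)] stable_closed[OF 2(1)]
      \<comment> \<open>The edge relator is respected because the edge group fixes the base arc, the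
        only term that the two sides do not obviously share.\<close>
      have "pi1_vertex \<Lambda> T ?a g \<in> \<E> e" using 2 by (simp add: edge_subgroup_def)
      then have fix_e: "translate \<pi> (pi1_vertex \<Lambda> T ?a g) (base_arc e) = base_arc e"
        using translate_base_arc_fixed 2(1) by blast
      have "f (VGen ?a g) \<otimes>\<^bsub>D\<^esub> f (Stable e) =
          (p ?a \<triangle> {base_arc e} \<triangle> ?tr (pi1_vertex \<Lambda> T ?a g \<otimes>\<^bsub>\<pi>\<^esub> \<tau> e) (p ?b),
            pi1_vertex \<Lambda> T ?a g \<otimes>\<^bsub>\<pi>\<^esub> \<tau> e)"
        using 2 c p[OF v(1)] p[OF v(2)]
        by (simp add: f_def D_mult tr symdiff_subset base_arc_X fix_e symdiff_assoc)
      also have "\<dots> = f (Stable e) \<otimes>\<^bsub>D\<^esub> f (VGen ?b ?k)"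
        using 2 c p[OF v(1)] p[OF v(2)]
        by (simp add: stable_commute f_def D_mult tr symdiff_subset base_arc_X symdiff_assoc)
      finally have eq: "f (VGen ?a g) \<otimes>\<^bsub>D\<^esub> f (Stable e) = f (Stable e) \<otimes>\<^bsub>D\<^esub> f (VGen ?b ?k)" .
      have fc: "f (VGen ?a g) \<in> carrier D" "f (VGen ?b ?k) \<in> carrier D" "f (Stable e) \<in> carrier D"
        using f VGen_gens[OF v(1) g(1)] VGen_gens[OF v(2) g(2)] Stable_gens[OF 2(1)] by auto
      have "D.word_value f r =
          (f (VGen ?a g) \<otimes>\<^bsub>D\<^esub> f (Stable e)) \<otimes>\<^bsub>D\<^esub> inv\<^bsub>D\<^esub> (f (Stable e) \<otimes>\<^bsub>D\<^esub> f (VGen ?b ?k))"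
        using fc by (simp add: 2(3) D.inv_mult_group D.m_assoc)
      then show ?thesis using fc by (simp add: eq)
    next
      case (3 e)
      then have e: "e \<in> arcs \<Gamma>" using tree_arcs by blast
      have v: "tail \<Gamma> e \<in> verts \<Gamma>" "head \<Gamma> e \<in> verts \<Gamma>" using e by auto
      have "p (tail \<Gamma> e) \<triangle> {base_arc e} \<triangle> ?tr \<one>\<^bsub>\<pi>\<^esub> (p (head \<Gamma> e)) = {}"
        using p_tree[OF 3(1)] p[OF v(2)] by (simp add: tr)
      then have "f (Stable e) = \<one>\<^bsub>D\<^esub>"
        by (simp add: f_def stable_tree[OF 3(1)] D_one)
      then show ?thesis by (simp add: 3(2))
    qed
  qed
  obtain \<phi> where \<phi>: "\<phi> \<in> hom \<pi> D" and \<phi>_gen: "\<And>x. x \<in> gens \<Longrightarrow> \<phi> (gen x) = f x"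
    using D.von_dyck[OF f rel] unfolding gen_def pi1_def by blast
  \<comment> \<open>The second component is an endomorphism that fixes the generators, hence the
    identity. So the multiplication rule of the semidirect product makes the first component a
    crossed homomorphism.\<close>
  have "(\<lambda>g. snd (\<phi> g)) \<in> hom \<pi> \<pi>"
    using \<phi> by (fastforce simp: hom_def Pi_iff D_def set_semidirect_def case_prod_beta)
  moreover have "(\<lambda>g. g) \<in> hom \<pi> \<pi>" by (simp add: hom_def)
  ultimately have snd_\<phi>: "snd (\<phi> g) = g" if "g \<in> carrier \<pi>" for g
  proof (rule pi.hom_generate_eq)
    show "gen ` gens \<subseteq> carrier \<pi>" using gen_closed by blast
    show "snd (\<phi> a) = a" if "a \<in> gen ` gens" for a
      using that \<phi>_gen snd_f by fastforce
    show "g \<in> generate \<pi> (gen ` gens)" using that generate_gens by simp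
  qed (fact pi.is_group)+
  define c where "c g = fst (\<phi> g)" for g
  have \<phi>_eq: "\<phi> g = (c g, g)" if "g \<in> carrier \<pi>" for g
    using snd_\<phi>[OF that] by (simp add: c_def prod_eq_iff)
  show thesis
  proof (rule that[of c])
    show "c g \<subseteq> arcs \<X>" if "g \<in> carrier \<pi>" for g
      using hom_in_carrier[OF \<phi> that] \<phi>_eq[OF that] D_carrier by simp
    show "c (g \<otimes>\<^bsub>\<pi>\<^esub> h) = c g \<triangle> translate \<pi> g ` c h" if "g \<in> carrier \<pi>" "h \<in> carrier \<pi>" for g h
      using hom_mult[OF \<phi> that] \<phi>_eq that D_mult by simp
    show "c g = p v \<triangle> translate \<pi> g ` p v" if v: "v \<in> verts \<Gamma>" "g \<in> \<G> v" for v g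
    proof -
      obtain h where "h \<in> carrier (vertex_group \<Lambda> v)" "g = pi1_vertex \<Lambda> T v h"
        using v by (auto simp: vertex_subgroup_def)
      then show ?thesis
        using \<phi>_gen[OF VGen_gens[OF v(1)], of h] by (simp add: c_def gen_simps f_def)
    qed
    show "c (\<tau> e) = p (tail \<Gamma> e) \<triangle> {base_arc e} \<triangle> translate \<pi> (\<tau> e) ` p (head \<Gamma> e)"
      if "e \<in> arcs \<Gamma>" for e
      using \<phi>_gen[OF Stable_gens[OF that]] by (simp add: c_def gen_simps f_def)
  qed
qed

lemma bass_serre_potential: "\<exists>P. potential_graph \<X> P"
proof -
  obtain q where q: "\<And>v. v \<in> verts T \<Longrightarrow> q v \<subseteq> arcs T"
    "\<And>e. e \<in> arcs T \<Longrightarrow> q (head T e) = q (tail T e) \<triangle> {e}"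
    using unoriented_tree_potential[OF tree_wf tree] by blast
  \<comment> \<open>The base vertices and the base arcs over \<open>T\<close> form a copy of
    \<open>T\<close>, to which its potential is transported.\<close>
  define p where "p v = base_arc ` q v" for v
  have p: "p v \<subseteq> arcs \<X>" if "v \<in> verts \<Gamma>" for v
    using q(1)[of v] that tree_verts tree_arcs base_arc_X unfolding p_def by blast
  have inj: "inj base_arc" by (auto simp: inj_def base_arc_def)
  have p_tree: "p (head \<Gamma> e) = p (tail \<Gamma> e) \<triangle> {base_arc e}" if "e \<in> arcs T" for e
    using q(2)[OF that] tree_ends image_symdiff[OF inj, of "q (tail \<Gamma> e)" "{e}"] by (simp add: p_def)
  obtain c where c: "\<And>g. g \<in> carrier \<pi> \<Longrightarrow> c g \<subseteq> arcs \<X>"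
    and c_mult: "\<And>g h. \<lbrakk>g \<in> carrier \<pi>; h \<in> carrier \<pi>\<rbrakk> \<Longrightarrow> c (g \<otimes>\<^bsub>\<pi>\<^esub> h) = c g \<triangle> translate \<pi> g ` c h"
    and c_vertex: "\<And>v g. \<lbrakk>v \<in> verts \<Gamma>; g \<in> \<G> v\<rbrakk> \<Longrightarrow> c g = p v \<triangle> translate \<pi> g ` p v"
    and c_stable: "\<And>e. e \<in> arcs \<Gamma> \<Longrightarrow>
      c (\<tau> e) = p (tail \<Gamma> e) \<triangle> {base_arc e} \<triangle> translate \<pi> (\<tau> e) ` p (head \<Gamma> e)"
    using crossed_homomorphism[of p, OF p p_tree] by blast
  note tr = arcs_action.act_image_closed arcs_action.act_image_mult arcs_action.act_image_symdiff
  define P where "P x = (let g = SOME g. g \<in> snd x in c g \<triangle> translate \<pi> g ` p (fst x))" for x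
  have P: "P (v, g <#\<^bsub>\<pi>\<^esub> \<G> v) = c g \<triangle> translate \<pi> g ` p v"
    if v: "v \<in> verts \<Gamma>" and g: "g \<in> carrier \<pi>" for v g
  proof -
    define h where "h = (SOME h. h \<in> g <#\<^bsub>\<pi>\<^esub> \<G> v)"
    have "h \<in> g <#\<^bsub>\<pi>\<^esub> \<G> v"
      unfolding h_def using pi.lcos_self[OF vertex_subgroup[OF v] g] by (rule someI)
    then obtain k where k: "k \<in> \<G> v" "h = g \<otimes>\<^bsub>\<pi>\<^esub> k"
      using pi.lcos_eqD[OF vertex_subgroup[OF v] g] by blast
    have "k \<in> carrier \<pi>" using k(1) coset_carrier(1)[OF v] by blast
    \<comment> \<open>Independence of the representative: the contribution of \<open>k\<close> is
      \<open>c k \<triangle> k (p v)\<close>, which equals \<open>p v\<close>.\<close>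
    then have "c h \<triangle> translate \<pi> h ` p v = c g \<triangle> translate \<pi> g ` p v"
      using g v p[OF v] by (simp add: k(2) c_mult c_vertex[OF v k(1)] tr symdiff_assoc)
    then show ?thesis by (simp add: P_def h_def[symmetric])
  qed
  have "potential_graph \<X> P"
  proof (intro potential_graph.intro wf_X potential_graph_axioms.intro connected_X)
    fix \<epsilon> assume "\<epsilon> \<in> arcs \<X>"
    then obtain e g where e: "e \<in> arcs \<Gamma>" and g: "g \<in> carrier \<pi>" and \<epsilon>: "\<epsilon> = (e, g <#\<^bsub>\<pi>\<^esub> \<E> e)"
      by (auto simp: arcs_X)
    have v: "tail \<Gamma> e \<in> verts \<Gamma>" "head \<Gamma> e \<in> verts \<Gamma>" using e by auto
    note t = stable_closed[OF e]
    \<comment> \<open>Expanding \<open>c (g \<otimes> \<tau> e)\<close>, the two translates of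
      \<open>p (head \<Gamma> e)\<close> cancel; what remains is the potential of the tail and the
      translate of the base arc, which is \<open>\<epsilon>\<close>.\<close>
    show "P (head \<X> \<epsilon>) = P (tail \<X> \<epsilon>) \<triangle> {\<epsilon>}"
      using e g t v p[OF v(1)] p[OF v(2)]
      by (simp add: \<epsilon> head_X tail_X P c_mult c_stable tr symdiff_subset base_arc_X symdiff_assoc
          translate_base_arc symdiff_commute[of "{(e, g <#\<^bsub>\<pi>\<^esub> \<E> e)}"])
  qed
  then show ?thesis by blast
qed

end

section \<open>Coxeter systems\<close>

lemma (in group) word_value_alternating:
  assumes "f s \<in> carrier G" "f t \<in> carrier G"
  shows "word_value f (concat (replicate k [(s, True), (t, True)])) = (f s \<otimes> f t) [^] k"
proof (induction k)
  case (Suc k)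
  then have "word_value f (concat (replicate (Suc k) [(s, True), (t, True)])) =
      (f s \<otimes> f t) \<otimes> (f s \<otimes> f t) [^] k"
    using assms by (simp add: m_assoc)
  then show ?case using assms by (simp only: nat_pow_Suc2 m_closed)
qed simp

text \<open>The last clause is the universal property of the presentation. The target
  \<open>H\<close> is fixed outside because its type cannot be quantified inside
  \<open>obtains\<close>.\<close>

lemma coxeter_systemE:
  fixes H :: "('h, 'c) monoid_scheme"
  assumes "coxeter_system W S"
  obtains m where "coxeter_matrix S m" "generate W S = carrier W"
    "\<And>s t k. \<lbrakk>s \<in> S; t \<in> S; m s t = enat k\<rbrakk> \<Longrightarrow> (s \<otimes>\<^bsub>W\<^esub> t) [^]\<^bsub>W\<^esub> k = \<one>\<^bsub>W\<^esub>"
    "\<And>f. \<lbrakk>group H; f \<in> S \<rightarrow> carrier H;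
        \<And>s t k. \<lbrakk>s \<in> S; t \<in> S; m s t = enat k\<rbrakk> \<Longrightarrow> (f s \<otimes>\<^bsub>H\<^esub> f t) [^]\<^bsub>H\<^esub> k = \<one>\<^bsub>H\<^esub>\<rbrakk> \<Longrightarrow>
      \<exists>\<psi>\<in>hom W H. \<forall>s\<in>S. \<psi> s = f s"
proof -
  obtain m h where m: "coxeter_matrix S m" and W: "group W"
    and h: "h \<in> iso (presented_group S (coxeter_relators S m)) W"
    and hs: "\<And>s. s \<in> S \<Longrightarrow> h (pres_class S (coxeter_relators S m) [(s, True)]) = s"
    using assms unfolding coxeter_system_def by blast
  let ?R = "coxeter_relators S m"
  let ?P = "presented_group S ?R"
  define \<sigma> where "\<sigma> s = pres_class S ?R [(s, True)]" for s
  interpret P: group ?P by (rule group_presented_group)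
  have h_hom: "h \<in> hom ?P W" and h_img: "h ` carrier ?P = carrier W"
    and h_inj: "inj_on h (carrier ?P)"
    using h by (simp_all add: iso_iff)
  interpret h: group_hom ?P W h
    using W h_hom P.is_group by (simp add: group_hom_def group_hom_axioms_def)
  have \<sigma>: "\<sigma> s \<in> carrier ?P" if "s \<in> S" for s
    using that by (auto simp: \<sigma>_def presented_group_def words_def)
  have gen: "generate W S = carrier W"
  proof -
    have "h ` \<sigma> ` S = S" using hs by (force simp: \<sigma>_def)
    then show ?thesis
      using h.generate_img[of "\<sigma> ` S"] \<sigma> generate_presented_group[of S ?R] h_img
      by (auto simp: \<sigma>_def[abs_def])
  qed
  have pow: "(s \<otimes>\<^bsub>W\<^esub> t) [^]\<^bsub>W\<^esub> k = \<one>\<^bsub>W\<^esub>" if st: "s \<in> S" "t \<in> S" "m s t = enat k" for s t k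
  proof -
    let ?r = "concat (replicate k [(s, True), (t, True)])"
    have r: "?r \<in> ?R" "?r \<in> words S"
      using st by (auto simp: coxeter_relators_def words_def split: if_splits)
    have "(\<sigma> s \<otimes>\<^bsub>?P\<^esub> \<sigma> t) [^]\<^bsub>?P\<^esub> k = P.word_value \<sigma> ?r"
      using P.word_value_alternating[of \<sigma> s t k] \<sigma> st by simp
    also have "\<dots> = \<one>\<^bsub>?P\<^esub>"
      using pres_class_relator[OF r] pres_class_conv_word_value[OF r(2), of ?R]
      by (simp add: \<sigma>_def[abs_def])
    finally have "h ((\<sigma> s \<otimes>\<^bsub>?P\<^esub> \<sigma> t) [^]\<^bsub>?P\<^esub> k) = \<one>\<^bsub>W\<^esub>" by simp
    moreover have "h (\<sigma> s) = s" "h (\<sigma> t) = t" using hs st by (simp_all add: \<sigma>_def)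
    ultimately show ?thesis using \<sigma> st by (simp add: h.hom_nat_pow)
  qed
  have extend: "\<exists>\<psi>\<in>hom W H. \<forall>s\<in>S. \<psi> s = f s"
    if H: "group H" and f: "f \<in> S \<rightarrow> carrier H"
      and rel: "\<And>s t k. \<lbrakk>s \<in> S; t \<in> S; m s t = enat k\<rbrakk> \<Longrightarrow> (f s \<otimes>\<^bsub>H\<^esub> f t) [^]\<^bsub>H\<^esub> k = \<one>\<^bsub>H\<^esub>"
    for f
  proof -
    interpret H: group H by fact
    have "H.word_value f r = \<one>\<^bsub>H\<^esub>" if "r \<in> ?R" "r \<in> words S" for r
    proof -
      obtain s t k where "s \<in> S" "t \<in> S" "m s t = enat k" "r = concat (replicate k [(s, True), (t, True)])"
        using \<open>r \<in> ?R\<close> by (auto simp: coxeter_relators_def)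
      then show ?thesis using H.word_value_alternating[of f s t k] rel f by auto
    qed
    then obtain \<phi> where \<phi>: "\<phi> \<in> hom ?P H" "\<And>s. s \<in> S \<Longrightarrow> \<phi> (\<sigma> s) = f s"
      using H.von_dyck[OF f, of ?R] unfolding \<sigma>_def by blast
    have inv: "inv_into (carrier ?P) h \<in> hom W ?P"
      using P.iso_set_sym[OF h] by (simp add: iso_iff)
    have "inv_into (carrier ?P) h s = \<sigma> s" if "s \<in> S" for s
      using inv_into_f_eq[OF h_inj \<sigma>[OF that]] hs[OF that] by (simp add: \<sigma>_def)
    then show ?thesis
      using \<phi> hom_compose[OF inv \<phi>(1)] by (intro bexI[of _ "\<phi> \<circ> inv_into (carrier ?P) h"]) auto
  qed
  show thesis using that m gen pow extend by blast
qed

section \<open>The visual decomposition\<close>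

text \<open>This and \<open>edge_relator_one\<close> have exactly the shape to which
  \<open>word_value\<close> unfolds on the relators of a graph of groups whose stable letters are
  sent to 1.\<close>

lemma (in group) mult_relator_one:
  assumes "a \<in> carrier G" "b \<in> carrier G"
  shows "a \<otimes> (b \<otimes> (inv (a \<otimes> b) \<otimes> \<one>)) = \<one>"
  using assms by (simp add: m_assoc[symmetric])

lemma (in group) edge_relator_one:
  assumes "a \<in> carrier G"
  shows "a \<otimes> (\<one> \<otimes> (inv a \<otimes> (inv \<one> \<otimes> \<one>))) = \<one>"
  using assms by simp

lemma (in group) subgroup_lcos_stabilizer:
  assumes "C \<subseteq> carrier G"
  shows "subgroup {g \<in> carrier G. g <#\<^bsub>G\<^esub> C = C} G"
proof (rule subgroupI)
  show "{g \<in> carrier G. g <#\<^bsub>G\<^esub> C = C} \<noteq> {}"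
    using lcos_mult_one[OF assms] by blast
  fix g assume g: "g \<in> {g \<in> carrier G. g <#\<^bsub>G\<^esub> C = C}"
  have "inv g <#\<^bsub>G\<^esub> (g <#\<^bsub>G\<^esub> C) = C"
    using g assms lcos_m_assoc[of C "inv g" g] by (simp add: lcos_mult_one)
  then show "inv g \<in> {g \<in> carrier G. g <#\<^bsub>G\<^esub> C = C}" using g by simp
  fix h assume "h \<in> {g \<in> carrier G. g <#\<^bsub>G\<^esub> C = C}"
  then show "g \<otimes> h \<in> {g \<in> carrier G. g <#\<^bsub>G\<^esub> C = C}"
    using g assms by (simp add: lcos_m_assoc[symmetric])
qed blast

text \<open>Stabilizers of vertices and arcs are conjugates of vertex and edge groups. Read from
  left to right this gives the subconjugacy claims, from right to left the claim about special
  subgroups.\<close>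

lemma (in group) lcos_fixed_iff:
  assumes H: "subgroup H G" and g: "g \<in> carrier G" and s: "s \<in> carrier G"
  shows "s <#\<^bsub>G\<^esub> (g <#\<^bsub>G\<^esub> H) = g <#\<^bsub>G\<^esub> H \<longleftrightarrow> s \<in> (g <#\<^bsub>G\<^esub> H) #> inv g"
proof -
  have sg: "s <#\<^bsub>G\<^esub> (g <#\<^bsub>G\<^esub> H) = (s \<otimes> g) <#\<^bsub>G\<^esub> H"
    using g s subgroup.subset[OF H] by (simp add: lcos_m_assoc)
  show ?thesis
  proof
    assume "s <#\<^bsub>G\<^esub> (g <#\<^bsub>G\<^esub> H) = g <#\<^bsub>G\<^esub> H"
    then have "s \<otimes> g \<in> g <#\<^bsub>G\<^esub> H" using lcos_self[OF H, of "s \<otimes> g"] sg g s by simp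
    moreover have "s = (s \<otimes> g) \<otimes> inv g" using g s by (simp add: m_assoc)
    ultimately show "s \<in> (g <#\<^bsub>G\<^esub> H) #> inv g" unfolding r_coset_def by blast
  next
    assume "s \<in> (g <#\<^bsub>G\<^esub> H) #> inv g"
    then obtain k where k: "k \<in> H" "s = (g \<otimes> k) \<otimes> inv g"
      by (auto simp: r_coset_def l_coset_def)
    then have "s \<otimes> g = g \<otimes> k" using g subgroup.mem_carrier[OF H] by (simp add: m_assoc)
    then show "s <#\<^bsub>G\<^esub> (g <#\<^bsub>G\<^esub> H) = g <#\<^bsub>G\<^esub> H"
      using lcos_subgroup_absorb[OF H g k(1)] sg by simp
  qed
qed

definition fixers :: "('a, 'c) monoid_scheme \<Rightarrow> 'a set \<Rightarrow> 'i \<times> 'a set \<Rightarrow> 'a set" where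
  "fixers G S x = {s \<in> S. translate G s x = x}"

text \<open>The stabilizer of \<open>x\<close> in \<open>W\<close> may be, say, a conjugate of a
  special subgroup without being special; generating by the elements of \<open>S\<close> that fix
  \<open>x\<close> makes the groups special and the edge maps inclusions.\<close>

definition visual_tree ::
  "('v, 'e, 'a) graph_of_groups \<Rightarrow> ('v, 'e) pre_digraph \<Rightarrow> ('v, 'e, 'a) pi1_elt set \<Rightarrow>
    ('v \<times> ('v, 'e, 'a) pi1_elt set, 'e \<times> ('v, 'e, 'a) pi1_elt set, ('v, 'e, 'a) pi1_elt) graph_of_groups"
where
  "visual_tree \<Lambda> T S =
    \<lparr>gog_graph = bass_serre_graph \<Lambda> T,
     vertex_group = (\<lambda>x. (pi1 \<Lambda> T)\<lparr>carrier := generate (pi1 \<Lambda> T) (fixers (pi1 \<Lambda> T) S x)\<rparr>),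
     edge_group = (\<lambda>\<epsilon>. generate (pi1 \<Lambda> T) (fixers (pi1 \<Lambda> T) S \<epsilon>)),
     edge_map = (\<lambda>_ g. g)\<rparr>"

locale coxeter_in_pi1 = graph_of_groups_pi1 \<Lambda> T
  for \<Lambda> :: "('v, 'e, 'a) graph_of_groups" and T :: "('v, 'e) pre_digraph" +
  fixes W S :: "('v, 'e, 'a) pi1_elt set"
  assumes subgroup_W: "subgroup W \<pi>"
    and coxeter: "coxeter_system (\<pi>\<lparr>carrier := W\<rparr>) S"
begin

abbreviation "\<Psi> \<equiv> visual_tree \<Lambda> T S"
abbreviation "fixing \<equiv> fixers \<pi> S"
abbreviation "\<W> \<equiv> \<pi>\<lparr>carrier := W\<rparr>"

lemma visual_tree_simps [simp]:
  "gog_graph \<Psi> = \<X>"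
  "vertex_group \<Psi> x = \<pi>\<lparr>carrier := generate \<pi> (fixing x)\<rparr>"
  "edge_group \<Psi> \<epsilon> = generate \<pi> (fixing \<epsilon>)"
  "edge_map \<Psi> \<epsilon> g = g"
  by (simp_all add: visual_tree_def)

sublocale W: group \<W>
  by (rule pi.subgroup_imp_group[OF subgroup_W])

lemma S_subset: "S \<subseteq> W"
  using coxeter by (simp add: coxeter_system_def)

lemma S_closed: "s \<in> S \<Longrightarrow> s \<in> carrier \<pi>"
  using S_subset subgroup.mem_carrier[OF subgroup_W] by blast

lemma fixing_subset: "fixing x \<subseteq> S" "fixing x \<subseteq> W" "fixing x \<subseteq> carrier \<pi>"
  using S_subset S_closed by (auto simp: fixers_def)

lemma generate_W: "A \<subseteq> W \<Longrightarrow> generate \<W> A = generate \<pi> A"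
  by (rule pi.generate_consistent[OF _ subgroup_W])

lemma subgroup_fixing: "subgroup (generate \<pi> (fixing x)) \<pi>"
  by (rule pi.generate_is_subgroup[OF fixing_subset(3)])

lemma generate_fixing_subset: "generate \<pi> (fixing x) \<subseteq> W"
  by (rule pi.generate_subgroup_incl[OF fixing_subset(2) subgroup_W])

lemma generate_fixing_carrier: "g \<in> generate \<pi> (fixing x) \<Longrightarrow> g \<in> carrier \<W>"
  using generate_fixing_subset[of x] by auto

lemma fixing_ends:
  assumes "\<epsilon> \<in> arcs \<X>"
  shows "fixing \<epsilon> \<subseteq> fixing (tail \<X> \<epsilon>)" "fixing \<epsilon> \<subseteq> fixing (head \<X> \<epsilon>)"
proof -
  have "translate \<pi> s (tail \<X> \<epsilon>) = tail \<X> \<epsilon> \<and> translate \<pi> s (head \<X> \<epsilon>) = head \<X> \<epsilon>"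
    if "s \<in> S" "translate \<pi> s \<epsilon> = \<epsilon>" for s
    using translate_ends[OF S_closed[OF that(1)] assms] that(2) by simp
  then show "fixing \<epsilon> \<subseteq> fixing (tail \<X> \<epsilon>)" "fixing \<epsilon> \<subseteq> fixing (head \<X> \<epsilon>)"
    by (auto simp: fixers_def)
qed

lemma special_fixing: "special_subgroup \<W> S (generate \<pi> (fixing x))"
  unfolding special_subgroup_def
  by (intro exI[of _ "fixing x"] conjI fixing_subset(1) generate_W[OF fixing_subset(2), symmetric])

lemma generate_fixing_stabilizes:
  assumes "snd x \<subseteq> carrier \<pi>" "g \<in> generate \<pi> (fixing x)"
  shows "g \<in> carrier \<pi> \<and> g <#\<^bsub>\<pi>\<^esub> snd x = snd x"
proof -
  have "fixing x \<subseteq> {g \<in> carrier \<pi>. g <#\<^bsub>\<pi>\<^esub> snd x = snd x}"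
    using S_closed by (cases x) (auto simp: fixers_def)
  then show ?thesis
    using pi.generate_subgroup_incl[OF _ pi.subgroup_lcos_stabilizer[OF assms(1)]] assms(2) by blast
qed

text \<open>Stated for an arbitrary subgroup \<open>H\<close> so that it serves vertices and arcs
  alike.\<close>

lemma subconjugate_fixing:
  assumes "subgroup H \<pi>" "g \<in> carrier \<pi>"
  shows "subconjugate \<pi> (generate \<pi> (fixing (i, g <#\<^bsub>\<pi>\<^esub> H))) H"
  unfolding subconjugate_def
proof (intro bexI[OF _ assms(2)] subsetI)
  fix s assume s: "s \<in> generate \<pi> (fixing (i, g <#\<^bsub>\<pi>\<^esub> H))"
  have "g <#\<^bsub>\<pi>\<^esub> H \<subseteq> carrier \<pi>"
    using pi.l_coset_subset_G subgroup.subset[OF assms(1)] assms(2) by blast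
  then have "s \<in> carrier \<pi>" "s <#\<^bsub>\<pi>\<^esub> (g <#\<^bsub>\<pi>\<^esub> H) = g <#\<^bsub>\<pi>\<^esub> H"
    using generate_fixing_stabilizes[OF _ s] by simp_all
  then show "s \<in> (g <#\<^bsub>\<pi>\<^esub> H) #>\<^bsub>\<pi>\<^esub> inv\<^bsub>\<pi>\<^esub> g"
    using pi.lcos_fixed_iff[OF assms] by blast
qed

text \<open>A conjugate of \<open>\<G> u\<close> by \<open>g\<close> stabilizes the vertex
  \<open>(u, g <# \<G> u)\<close>, so the generators of \<open>H\<close> belong to the set that
  generates the group attached there.\<close>

lemma special_subconjugate:
  assumes "special_subgroup \<W> S H" "u \<in> verts \<Gamma>" "subconjugate \<pi> H (\<G> u)"
  shows "\<exists>x\<in>verts \<X>. H \<subseteq> generate \<pi> (fixing x)"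
proof -
  obtain A where A: "A \<subseteq> S" "H = generate \<W> A" using assms(1) by (auto simp: special_subgroup_def)
  obtain g where g: "g \<in> carrier \<pi>" "H \<subseteq> (g <#\<^bsub>\<pi>\<^esub> \<G> u) #>\<^bsub>\<pi>\<^esub> inv\<^bsub>\<pi>\<^esub> g"
    using assms(3) by (auto simp: subconjugate_def)
  have "A \<subseteq> fixing (u, g <#\<^bsub>\<pi>\<^esub> \<G> u)"
  proof
    fix a assume a: "a \<in> A"
    then have "a \<in> H" unfolding A(2) by (rule generate.incl)
    then have "a \<in> (g <#\<^bsub>\<pi>\<^esub> \<G> u) #>\<^bsub>\<pi>\<^esub> inv\<^bsub>\<pi>\<^esub> g" using g(2) by blast
    moreover have "a \<in> S" using a A(1) by blast
    ultimately show "a \<in> fixing (u, g <#\<^bsub>\<pi>\<^esub> \<G> u)"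
      using pi.lcos_fixed_iff[OF vertex_subgroup[OF assms(2)] g(1) S_closed] by (simp add: fixers_def)
  qed
  then have "H \<subseteq> generate \<pi> (fixing (u, g <#\<^bsub>\<pi>\<^esub> \<G> u))"
    using pi.mono_generate A(2) generate_W[OF subset_trans[OF A(1) S_subset]] by simp
  then show ?thesis using vert_XI[OF assms(2) g(1)] by blast
qed

lemma translate_automorphism:
  assumes "potential_graph \<X> P" "g \<in> carrier \<pi>"
  shows "potential_graph.automorphism \<X> (translate \<pi> g) (translate \<pi> g)"
  unfolding potential_graph.automorphism_def[OF assms(1)]
  by (intro conjI ballI image_subsetI group_acting.act_closed[OF group_acting_verts assms(2)]
      arcs_action.act_closed[OF assms(2)] arcs_action.act_inj[OF assms(2)] translate_ends[OF assms(2)])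

lemma is_graph_of_groups_visual_tree: "is_graph_of_groups \<Psi>"
proof -
  have "subgroup (generate \<pi> (fixing \<epsilon>)) (\<pi>\<lparr>carrier := generate \<pi> (fixing (tail \<X> \<epsilon>))\<rparr>)"
    "edge_map \<Psi> \<epsilon> \<in> mon (\<pi>\<lparr>carrier := generate \<pi> (fixing \<epsilon>)\<rparr>)
      (\<pi>\<lparr>carrier := generate \<pi> (fixing (head \<X> \<epsilon>))\<rparr>)" if \<epsilon>: "\<epsilon> \<in> arcs \<X>" for \<epsilon>
  proof -
    show "subgroup (generate \<pi> (fixing \<epsilon>)) (\<pi>\<lparr>carrier := generate \<pi> (fixing (tail \<X> \<epsilon>))\<rparr>)"
      by (intro pi.subgroup_incl subgroup_fixing pi.mono_generate fixing_ends[OF \<epsilon>])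
    show "edge_map \<Psi> \<epsilon> \<in> mon (\<pi>\<lparr>carrier := generate \<pi> (fixing \<epsilon>)\<rparr>)
        (\<pi>\<lparr>carrier := generate \<pi> (fixing (head \<X> \<epsilon>))\<rparr>)"
      using pi.mono_generate[OF fixing_ends(2)[OF \<epsilon>]] by (auto simp: mon_def hom_def inj_on_def)
  qed
  then show ?thesis
    using wf_X connected_X
    by (simp add: is_graph_of_groups_def pi.subgroup_imp_group[OF subgroup_fixing])
qed

lemma unoriented_spanning_tree_visual_tree: "unoriented_spanning_tree \<X> \<X>"
proof -
  obtain P where "potential_graph \<X> P" using bass_serre_potential by blast
  then have "unoriented_tree \<X>" by (rule potential_graph.unoriented_tree)
  then show ?thesis
    using wf_X by (simp add: unoriented_spanning_tree_def spanning_def subgraph_def compatible_def)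
qed

text \<open>The facts about fundamental groups are applied a second time, with the whole tree as
  spanning tree: all stable letters become 1, and the edge relators merely identify elements of
  adjacent vertex groups.\<close>

sublocale Psi: graph_of_groups_pi1 \<Psi> \<X>
  by unfold_locales (simp_all add: is_graph_of_groups_visual_tree unoriented_spanning_tree_visual_tree)

section \<open>Inverse homomorphisms between the fundamental group and \<open>W\<close>\<close>

lemma pi1_visual_tree_to_W:
  obtains h where "h \<in> hom (pi1 \<Psi> \<X>) \<W>"
    "\<And>x g. \<lbrakk>x \<in> verts \<X>; g \<in> generate \<pi> (fixing x)\<rbrakk> \<Longrightarrow> h (pi1_vertex \<Psi> \<X> x g) = g"
    "\<And>\<epsilon>. \<epsilon> \<in> arcs \<X> \<Longrightarrow> h (pi1_stable \<Psi> \<X> \<epsilon>) = \<one>\<^bsub>\<W>\<^esub>"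
proof -
  define f :: "('v \<times> ('v, 'e, 'a) pi1_elt set, 'e \<times> ('v, 'e, 'a) pi1_elt set, ('v, 'e, 'a) pi1_elt) gog_gen
      \<Rightarrow> ('v, 'e, 'a) pi1_elt"
    where "f = case_gog_gen (\<lambda>_ g. g) (\<lambda>_. \<one>\<^bsub>\<W>\<^esub>)"
  have f_simps [simp]: "f (VGen x g) = g" "f (Stable \<epsilon>) = \<one>\<^bsub>\<W>\<^esub>" for x g \<epsilon>
    by (simp_all add: f_def)
  have f: "f \<in> gog_gens \<Psi> \<rightarrow> carrier \<W>"
    using generate_fixing_carrier W.one_closed by (auto simp: gog_gens_def)
  have rel: "W.word_value f r = \<one>\<^bsub>\<W>\<^esub>" if "r \<in> gog_relators \<Psi> \<X>" "r \<in> words (gog_gens \<Psi>)" for r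
  proof -
    consider x g h where "g \<in> generate \<pi> (fixing x)" "h \<in> generate \<pi> (fixing x)"
        "r = [(VGen x g, True), (VGen x h, True), (VGen x (g \<otimes>\<^bsub>\<W>\<^esub> h), False)]"
      | \<epsilon> g where "g \<in> generate \<pi> (fixing \<epsilon>)"
        "r = [(VGen (tail \<X> \<epsilon>) g, True), (Stable \<epsilon>, True), (VGen (head \<X> \<epsilon>) g, False), (Stable \<epsilon>, False)]"
      | \<epsilon> where "r = [(Stable \<epsilon>, True)]"
      using \<open>r \<in> gog_relators \<Psi> \<X>\<close> by (auto simp: gog_relators_def)
    then show ?thesis
    proof cases
      case (1 x g h)
      have c: "g \<in> carrier \<W>" "h \<in> carrier \<W>" using 1 generate_fixing_carrier by blast+
      show ?thesis
        unfolding 1(3) W.word_value.simps f_simps if_True if_False by (rule W.mult_relator_one[OF c])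
    next
      case (2 \<epsilon> g)
      have "g \<in> carrier \<W>" using 2 generate_fixing_carrier by blast
      then show ?thesis
        unfolding 2(2) W.word_value.simps f_simps if_True if_False by (rule W.edge_relator_one)
    next
      case (3 \<epsilon>)
      show ?thesis
        unfolding 3 W.word_value.simps f_simps if_True by (rule W.r_one[OF W.one_closed])
    qed
  qed
  obtain h where h: "h \<in> hom (pi1 \<Psi> \<X>) \<W>" "\<And>x. x \<in> gog_gens \<Psi> \<Longrightarrow> h (Psi.gen x) = f x"
    using W.von_dyck[OF f rel] unfolding Psi.gen_def pi1_def by blast
  show thesis
  proof (rule that[OF h(1)])
    show "h (pi1_vertex \<Psi> \<X> x g) = g" if "x \<in> verts \<X>" "g \<in> generate \<pi> (fixing x)" for x g
      using h(2)[OF Psi.VGen_gens[of x g]] that by (simp add: Psi.gen_simps)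
    show "h (pi1_stable \<Psi> \<X> \<epsilon>) = \<one>\<^bsub>\<W>\<^esub>" if "\<epsilon> \<in> arcs \<X>" for \<epsilon>
      using h(2)[OF Psi.Stable_gens[of \<epsilon>]] that by (simp add: Psi.gen_simps)
  qed
qed

text \<open>The relation between \<open>s\<close> and \<open>t\<close> says that the composite of
  their translations is periodic. With \<open>t = s\<close> and \<open>k = 1\<close> this gives a
  vertex fixed by \<open>s\<close> alone.\<close>

lemma common_fixed_vertex:
  fixes k :: nat
  assumes "s \<in> S" "t \<in> S" "s \<otimes>\<^bsub>\<pi>\<^esub> s = \<one>\<^bsub>\<pi>\<^esub>" "t \<otimes>\<^bsub>\<pi>\<^esub> t = \<one>\<^bsub>\<pi>\<^esub>"
    and "k > 0" "(s \<otimes>\<^bsub>\<pi>\<^esub> t) [^]\<^bsub>\<pi>\<^esub> k = \<one>\<^bsub>\<pi>\<^esub>"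
  obtains x where "x \<in> verts \<X>" "s \<in> fixing x" "t \<in> fixing x"
proof -
  obtain P where P: "potential_graph \<X> P" using bass_serre_potential by blast
  interpret X: potential_graph \<X> P by fact
  interpret verts_action: group_acting \<pi> "verts \<X>" "translate \<pi>" by (rule group_acting_verts)
  note st = S_closed[OF assms(1)] S_closed[OF assms(2)]
  obtain x0 where x0: "x0 \<in> verts \<X>"
    using connected_X by (auto simp: connected_def strongly_connected_def mk_symmetric_def)
  have iter: "((translate \<pi> s \<circ> translate \<pi> t) ^^ n) x = translate \<pi> ((s \<otimes>\<^bsub>\<pi>\<^esub> t) [^]\<^bsub>\<pi>\<^esub> n) x"
    if x: "x \<in> verts \<X>" for n x
  proof (induction n)
    case (Suc n)
    let ?c = "s \<otimes>\<^bsub>\<pi>\<^esub> t"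
    have c: "?c \<in> carrier \<pi>" "?c [^]\<^bsub>\<pi>\<^esub> n \<in> carrier \<pi>" using st by simp_all
    have "translate \<pi> (?c [^]\<^bsub>\<pi>\<^esub> Suc n) x = translate \<pi> (?c \<otimes>\<^bsub>\<pi>\<^esub> ?c [^]\<^bsub>\<pi>\<^esub> n) x"
      by (simp only: pi.nat_pow_Suc2[OF c(1)])
    also have "\<dots> = translate \<pi> s (translate \<pi> t (translate \<pi> (?c [^]\<^bsub>\<pi>\<^esub> n) x))"
      using verts_action.act_mult[OF c x] verts_action.act_mult[OF st verts_action.act_closed[OF c(2) x]] by simp
    finally show ?case using Suc by simp
  qed (use verts_action.act_one[OF x] in simp)
  have "\<exists>x\<in>verts \<X>. translate \<pi> s x = x \<and> translate \<pi> t x = x"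
  proof (rule X.common_fixed_vertex[OF translate_automorphism[OF P st(1)] translate_automorphism[OF P st(2)]])
    show "translate \<pi> s (translate \<pi> s x) = x" "translate \<pi> t (translate \<pi> t x) = x"
      if "x \<in> verts \<X>" for x
      using that st assms(3,4) verts_action.act_mult[of s s x] verts_action.act_mult[of t t x]
        verts_action.act_one by simp_all
    show "translate \<pi> s (translate \<pi> s \<epsilon>) = \<epsilon>" if "\<epsilon> \<in> arcs \<X>" for \<epsilon>
      using that st assms(3) arcs_action.act_mult[of s s \<epsilon>] arcs_action.act_one by simp
    show "((translate \<pi> s \<circ> translate \<pi> t) ^^ k) x = x" if "x \<in> verts \<X>" for x
      using iter[OF that, of k] assms(6) verts_action.act_one[OF that] by simp
  qed (use x0 assms(5) in auto)
  then show thesis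
    using that assms(1,2) by (auto simp: fixers_def)
qed

text \<open>An arc fixed by \<open>s\<close> has \<open>s\<close> in its edge group, and its stable
  letter is 1, so its relator equates the copies of \<open>s\<close> at its two ends. Fixed arcs
  lead from \<open>x\<close> to \<open>y\<close>.\<close>

lemma pi1_vertex_fixing_eq:
  assumes "x \<in> verts \<X>" "s \<in> fixing x" "y \<in> verts \<X>" "s \<in> fixing y"
  shows "pi1_vertex \<Psi> \<X> x s = pi1_vertex \<Psi> \<X> y s"
proof -
  obtain P where P: "potential_graph \<X> P" using bass_serre_potential by blast
  interpret X: potential_graph \<X> P by fact
  have s: "s \<in> S" "translate \<pi> s x = x" "translate \<pi> s y = y"
    using assms by (simp_all add: fixers_def)
  show ?thesis
  proof (rule X.fixed_subgraph_induct[OF translate_automorphism[OF P S_closed[OF s(1)]] assms(1) s(2) assms(3) s(3)])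
    fix \<epsilon> assume \<epsilon>: "\<epsilon> \<in> arcs \<X>" "translate \<pi> s \<epsilon> = \<epsilon>"
    then have "s \<in> fixing \<epsilon>" using s(1) by (simp add: fixers_def)
    then have edge: "s \<in> edge_group \<Psi> \<epsilon>" by (simp add: generate.incl)
    have ends: "tail \<X> \<epsilon> \<in> verts \<X>" "head \<X> \<epsilon> \<in> verts \<X>"
      using \<epsilon>(1) wf_X by (simp_all add: wf_digraph_def)
    have c: "pi1_vertex \<Psi> \<X> (tail \<X> \<epsilon>) s \<in> carrier (pi1 \<Psi> \<X>)"
        "pi1_vertex \<Psi> \<X> (head \<X> \<epsilon>) s \<in> carrier (pi1 \<Psi> \<X>)"
      using Psi.pi1_vertex_closed[of "tail \<X> \<epsilon>" s] Psi.pi1_vertex_closed[of "head \<X> \<epsilon>" s]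
        Psi.edge_group_carrier[of \<epsilon> s] Psi.edge_map_carrier[of \<epsilon> s] \<epsilon>(1) ends edge
      unfolding visual_tree_simps by blast+
    have "pi1_vertex \<Psi> \<X> (tail \<X> \<epsilon>) s = pi1_vertex \<Psi> \<X> (head \<X> \<epsilon>) s"
      using Psi.stable_commute[of \<epsilon> s] Psi.stable_tree[of \<epsilon>] \<epsilon>(1) edge c
        Psi.pi.l_one[OF c(2)] Psi.pi.r_one[OF c(1)] unfolding visual_tree_simps by metis
    then show "pi1_vertex \<Psi> \<X> (tail \<X> \<epsilon>) s = pi1_vertex \<Psi> \<X> y s \<longleftrightarrow>
        pi1_vertex \<Psi> \<X> (head \<X> \<epsilon>) s = pi1_vertex \<Psi> \<X> y s" by simp
  qed simp
qed

lemma pi1_vertex_group_hom: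
  assumes "x \<in> verts \<X>"
  shows "group_hom (\<pi>\<lparr>carrier := generate \<pi> (fixing x)\<rparr>) (pi1 \<Psi> \<X>) (pi1_vertex \<Psi> \<X> x)"
  using Psi.pi1_vertex_hom[of x] assms pi.subgroup_imp_group[OF subgroup_fixing] Psi.pi.is_group
  unfolding visual_tree_simps group_hom_def group_hom_axioms_def by blast

text \<open>The last two conclusions are provided here because they depend on the Coxeter matrix,
  which is visible only in this proof; they are used to check on \<open>S\<close> that
  \<open>k\<close> is inverse to the map to \<open>W\<close>.\<close>

lemma W_to_pi1_visual_tree:
  obtains k where "k \<in> hom \<W> (pi1 \<Psi> \<X>)"
    "\<And>x s. \<lbrakk>x \<in> verts \<X>; s \<in> fixing x\<rbrakk> \<Longrightarrow> k s = pi1_vertex \<Psi> \<X> x s"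
    "\<And>s. s \<in> S \<Longrightarrow> \<exists>x\<in>verts \<X>. s \<in> fixing x" "generate \<W> S = W"
proof -
  obtain m where m: "coxeter_matrix S m" and gen: "generate \<W> S = carrier \<W>"
    and pow: "\<And>s t k. \<lbrakk>s \<in> S; t \<in> S; m s t = enat k\<rbrakk> \<Longrightarrow> (s \<otimes>\<^bsub>\<W>\<^esub> t) [^]\<^bsub>\<W>\<^esub> k = \<one>\<^bsub>\<W>\<^esub>"
    and extend: "\<And>f. \<lbrakk>group (pi1 \<Psi> \<X>); f \<in> S \<rightarrow> carrier (pi1 \<Psi> \<X>);
        \<And>s t k. \<lbrakk>s \<in> S; t \<in> S; m s t = enat k\<rbrakk> \<Longrightarrow>
          (f s \<otimes>\<^bsub>pi1 \<Psi> \<X>\<^esub> f t) [^]\<^bsub>pi1 \<Psi> \<X>\<^esub> k = \<one>\<^bsub>pi1 \<Psi> \<X>\<^esub>\<rbrakk> \<Longrightarrow>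
      \<exists>\<psi>\<in>hom \<W> (pi1 \<Psi> \<X>). \<forall>s\<in>S. \<psi> s = f s"
    by (rule coxeter_systemE[OF coxeter, where H = "pi1 \<Psi> \<X>"]) blast
  have pow: "(s \<otimes>\<^bsub>\<pi>\<^esub> t) [^]\<^bsub>\<pi>\<^esub> k = \<one>\<^bsub>\<pi>\<^esub>" if "s \<in> S" "t \<in> S" "m s t = enat k" for s t k
    using pow[OF that] pi.nat_pow_consistent[of "s \<otimes>\<^bsub>\<pi>\<^esub> t" k W] by simp
  have invol: "s \<otimes>\<^bsub>\<pi>\<^esub> s = \<one>\<^bsub>\<pi>\<^esub>" if "s \<in> S" for s
  proof -
    have "m s s = enat 1" using m that by (simp add: coxeter_matrix_def one_enat_def)
    then show ?thesis using pow[OF that that] S_closed[OF that] by fastforce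
  qed
  have common: "\<exists>x\<in>verts \<X>. s \<in> fixing x \<and> t \<in> fixing x"
    if "s \<in> S" "t \<in> S" "m s t = enat k" for s t k
  proof -
    have "1 \<le> m s t" using m that unfolding coxeter_matrix_def by blast
    then have "k > 0" using that(3) by (simp add: one_enat_def)
    then show ?thesis
      using common_fixed_vertex[OF that(1,2) invol[OF that(1)] invol[OF that(2)] _ pow[OF that]] by blast
  qed
  \<comment> \<open>By \<open>pi1_vertex_fixing_eq\<close> any fixed vertex gives the same value, so
    for each pair \<open>s\<close>, \<open>t\<close> the copies in one vertex group fixed by both
    can be used.\<close>
  define f where "f s = pi1_vertex \<Psi> \<X> (SOME x. x \<in> verts \<X> \<and> s \<in> fixing x) s" for s
  have f: "f s = pi1_vertex \<Psi> \<X> x s" if "x \<in> verts \<X>" "s \<in> fixing x" for x s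
  proof -
    have "(SOME x. x \<in> verts \<X> \<and> s \<in> fixing x) \<in> verts \<X> \<and> s \<in> fixing (SOME x. x \<in> verts \<X> \<and> s \<in> fixing x)"
      by (rule someI[of _ x]) (use that in blast)
    then show ?thesis unfolding f_def using pi1_vertex_fixing_eq that by blast
  qed
  have rel: "f s \<in> carrier (pi1 \<Psi> \<X>) \<and> (f s \<otimes>\<^bsub>pi1 \<Psi> \<X>\<^esub> f t) [^]\<^bsub>pi1 \<Psi> \<X>\<^esub> k = \<one>\<^bsub>pi1 \<Psi> \<X>\<^esub>"
    if st: "s \<in> S" "t \<in> S" "m s t = enat k" for s t k
  proof -
    obtain x where x: "x \<in> verts \<X>" "s \<in> fixing x" "t \<in> fixing x" using common[OF st] by blast
    let ?V = "\<pi>\<lparr>carrier := generate \<pi> (fixing x)\<rparr>"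
    interpret v: group_hom ?V "pi1 \<Psi> \<X>" "pi1_vertex \<Psi> \<X> x" by (rule pi1_vertex_group_hom[OF x(1)])
    have c: "s \<in> carrier ?V" "t \<in> carrier ?V" using x(2,3) by (simp_all add: generate.incl)
    have "(f s \<otimes>\<^bsub>pi1 \<Psi> \<X>\<^esub> f t) [^]\<^bsub>pi1 \<Psi> \<X>\<^esub> k = pi1_vertex \<Psi> \<X> x ((s \<otimes>\<^bsub>?V\<^esub> t) [^]\<^bsub>?V\<^esub> k)"
      using v.hom_nat_pow[OF v.G.m_closed[OF c]] v.hom_mult[OF c] f[OF x(1)] x(2,3) by metis
    also have "(s \<otimes>\<^bsub>?V\<^esub> t) [^]\<^bsub>?V\<^esub> k = \<one>\<^bsub>?V\<^esub>"
      using pow[OF st] pi.nat_pow_consistent[of "s \<otimes>\<^bsub>\<pi>\<^esub> t" k] by simp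
    finally have "(f s \<otimes>\<^bsub>pi1 \<Psi> \<X>\<^esub> f t) [^]\<^bsub>pi1 \<Psi> \<X>\<^esub> k = \<one>\<^bsub>pi1 \<Psi> \<X>\<^esub>"
      using v.hom_one by metis
    then show ?thesis using v.hom_closed[OF c(1)] f[OF x(1,2)] by simp
  qed
  have self: "m s s = enat 1" if "s \<in> S" for s
    using m that by (simp add: coxeter_matrix_def one_enat_def)
  have in_carrier: "f \<in> S \<rightarrow> carrier (pi1 \<Psi> \<X>)"
    using rel self by blast
  have "\<exists>\<psi>\<in>hom \<W> (pi1 \<Psi> \<X>). \<forall>s\<in>S. \<psi> s = f s"
    by (rule extend[OF Psi.pi.is_group in_carrier]) (use rel in blast)
  then obtain \<psi> where \<psi>: "\<psi> \<in> hom \<W> (pi1 \<Psi> \<X>)" "\<And>s. s \<in> S \<Longrightarrow> \<psi> s = f s" by blast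
  show thesis
  proof (rule that[OF \<psi>(1)])
    show "\<psi> s = pi1_vertex \<Psi> \<X> x s" if "x \<in> verts \<X>" "s \<in> fixing x" for x s
      using f[OF that] \<psi>(2)[of s] that(2) by (simp add: fixers_def)
    show "\<exists>x\<in>verts \<X>. s \<in> fixing x" if "s \<in> S" for s
      using common[OF that that self[OF that]] by blast
    show "generate \<W> S = W" using gen by simp
  qed
qed

lemma visual_decomposition_visual_tree: "visual_decomposition \<W> S \<Psi>"
proof -
  let ?Q = "pi1 \<Psi> \<X>"
  obtain h where h: "h \<in> hom ?Q \<W>"
    and h_vertex: "\<And>x g. \<lbrakk>x \<in> verts \<X>; g \<in> generate \<pi> (fixing x)\<rbrakk> \<Longrightarrow> h (pi1_vertex \<Psi> \<X> x g) = g"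
    and h_stable: "\<And>\<epsilon>. \<epsilon> \<in> arcs \<X> \<Longrightarrow> h (pi1_stable \<Psi> \<X> \<epsilon>) = \<one>\<^bsub>\<W>\<^esub>"
    using pi1_visual_tree_to_W by blast
  obtain k where k: "k \<in> hom \<W> ?Q"
    and k_S: "\<And>x s. \<lbrakk>x \<in> verts \<X>; s \<in> fixing x\<rbrakk> \<Longrightarrow> k s = pi1_vertex \<Psi> \<X> x s"
    and fixed: "\<And>s. s \<in> S \<Longrightarrow> \<exists>x\<in>verts \<X>. s \<in> fixing x" and gen: "generate \<W> S = W"
    using W_to_pi1_visual_tree by blast
  have hk: "h (k w) = w" if "w \<in> W" for w
  proof -
    have "(h \<circ> k) w = (\<lambda>w. w) w"
    proof (rule W.hom_generate_eq)
      show "h \<circ> k \<in> hom \<W> \<W>" by (rule hom_compose[OF k h])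
      show "(\<lambda>w. w) \<in> hom \<W> \<W>" by (simp add: hom_def)
      show "S \<subseteq> carrier \<W>" using S_subset by simp
      show "w \<in> generate \<W> S" using that gen by simp
      fix s assume "s \<in> S"
      then obtain x where x: "x \<in> verts \<X>" "s \<in> fixing x" using fixed by blast
      then show "(h \<circ> k) s = s"
        using k_S[OF x] h_vertex[OF x(1) generate.incl[OF x(2)]] by simp
    qed (rule W.is_group)
    then show ?thesis by simp
  qed
  \<comment> \<open>\<open>k\<close> is known only on \<open>S\<close>, but the generators of the
    fundamental group include all elements of the vertex groups. Both sides are homomorphisms on the
    vertex group and agree on \<open>fixing x\<close>, which generates it.\<close>
  have k_vertex: "k g = pi1_vertex \<Psi> \<X> x g" if x: "x \<in> verts \<X>" and g: "g \<in> generate \<pi> (fixing x)" for x g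
  proof -
    let ?V = "\<pi>\<lparr>carrier := generate \<pi> (fixing x)\<rparr>"
    interpret v: group_hom ?V ?Q "pi1_vertex \<Psi> \<X> x" by (rule pi1_vertex_group_hom[OF x])
    show ?thesis
    proof (rule v.G.hom_generate_eq)
      show "k \<in> hom ?V ?Q"
      proof (rule homI)
        fix a b assume a: "a \<in> carrier ?V" and b: "b \<in> carrier ?V"
        then have ab: "a \<in> carrier \<W>" "b \<in> carrier \<W>"
          using generate_fixing_subset[of x] by auto
        show "k a \<in> carrier ?Q" by (rule hom_in_carrier[OF k ab(1)])
        show "k (a \<otimes>\<^bsub>?V\<^esub> b) = k a \<otimes>\<^bsub>?Q\<^esub> k b" using hom_mult[OF k ab] by simp
      qed
      show "fixing x \<subseteq> carrier ?V" by (auto intro: generate.incl)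
      have "fixing x \<subseteq> generate \<pi> (fixing x)" by (auto intro: generate.incl)
      then show "g \<in> generate ?V (fixing x)"
        using g by (simp only: pi.generate_consistent[OF _ subgroup_fixing])
    qed (fact v.homh Psi.pi.is_group k_S[OF x])+
  qed
  have kh: "k (h q) = q" if "q \<in> carrier ?Q" for q
  proof -
    have "(k \<circ> h) q = (\<lambda>q. q) q"
    proof (rule Psi.pi.hom_generate_eq)
      show "k \<circ> h \<in> hom ?Q ?Q" by (rule hom_compose[OF h k])
      show "(\<lambda>q. q) \<in> hom ?Q ?Q" by (simp add: hom_def)
      show "Psi.gen ` gog_gens \<Psi> \<subseteq> carrier ?Q" using Psi.gen_closed by blast
      show "q \<in> generate ?Q (Psi.gen ` gog_gens \<Psi>)" using that Psi.generate_gens by simp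
      fix y assume "y \<in> Psi.gen ` gog_gens \<Psi>"
      then consider x g where "x \<in> verts \<X>" "g \<in> generate \<pi> (fixing x)" "y = pi1_vertex \<Psi> \<X> x g"
        | \<epsilon> where "\<epsilon> \<in> arcs \<X>" "y = pi1_stable \<Psi> \<X> \<epsilon>"
        by (auto simp: gog_gens_def Psi.gen_simps)
      then show "(k \<circ> h) y = y"
      proof cases
        case (1 x g)
        then show ?thesis by (simp add: h_vertex k_vertex)
      next
        case (2 \<epsilon>)
        have "k \<one>\<^bsub>\<W>\<^esub> = \<one>\<^bsub>?Q\<^esub>" by (rule hom_one[OF k W.is_group Psi.pi.is_group])
        then have "k (h y) = \<one>\<^bsub>?Q\<^esub>" by (simp only: 2(2) h_stable[OF 2(1)])
        then show ?thesis using Psi.stable_tree[of \<epsilon>] 2 by simp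
      qed
    qed (rule Psi.pi.is_group)
    then show ?thesis by simp
  qed
  have "bij_betw h (carrier ?Q) (carrier \<W>)"
    by (rule bij_betw_byWitness[where f' = k])
      (use hk kh hom_in_carrier[OF h] hom_in_carrier[OF k] in auto)
  then have "h \<in> iso ?Q \<W>" using h by (simp add: iso_def)
  then have "\<exists>T. unoriented_spanning_tree T \<X> \<and> (\<exists>h\<in>iso (pi1 \<Psi> T) \<W>.
      (\<forall>x\<in>verts \<X>. \<forall>g\<in>generate \<pi> (fixing x). h (pi1_vertex \<Psi> T x g) = g) \<and>
      (\<forall>\<epsilon>\<in>arcs \<X>. h (pi1_stable \<Psi> T \<epsilon>) = \<one>\<^bsub>\<W>\<^esub>))"
    using unoriented_spanning_tree_visual_tree h_vertex h_stable by blast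
  moreover have "\<exists>H. special_subgroup \<W> S H \<and> vertex_group \<Psi> x = \<W>\<lparr>carrier := H\<rparr>" for x
    using special_fixing[of x] by auto
  ultimately show ?thesis
    unfolding visual_decomposition_def
    using is_graph_of_groups_visual_tree by (simp add: special_fixing)
qed

end

theorem theorem1:
  fixes \<Lambda> :: "('v, 'e, 'a) graph_of_groups"
    and T :: "('v, 'e) pre_digraph"
    and W S :: "('v, 'e, 'a) pi1_elt set"
  assumes "is_graph_of_groups \<Lambda>"
    and "unoriented_spanning_tree T (gog_graph \<Lambda>)"
    and "subgroup W (pi1 \<Lambda> T)"
    and "coxeter_system ((pi1 \<Lambda> T)\<lparr>carrier := W\<rparr>) S"
  shows "\<exists>\<Psi> :: ('v \<times> ('v, 'e, 'a) pi1_elt set, 'e \<times> ('v, 'e, 'a) pi1_elt set,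
                ('v, 'e, 'a) pi1_elt) graph_of_groups.
    visual_decomposition ((pi1 \<Lambda> T)\<lparr>carrier := W\<rparr>) S \<Psi> \<and>
    (\<forall>v \<in> verts (gog_graph \<Psi>). \<exists>u \<in> verts (gog_graph \<Lambda>).
      subconjugate (pi1 \<Lambda> T) (carrier (vertex_group \<Psi> v)) (vertex_subgroup \<Lambda> T u)) \<and>
    (\<forall>e \<in> arcs (gog_graph \<Psi>). \<exists>d \<in> arcs (gog_graph \<Lambda>).
      subconjugate (pi1 \<Lambda> T) (edge_group \<Psi> e) (edge_subgroup \<Lambda> T d)) \<and>
    (\<forall>H. special_subgroup ((pi1 \<Lambda> T)\<lparr>carrier := W\<rparr>) S H \<and>
        (\<exists>u \<in> verts (gog_graph \<Lambda>). subconjugate (pi1 \<Lambda> T) H (vertex_subgroup \<Lambda> T u)) \<longrightarrow>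
      (\<exists>v \<in> verts (gog_graph \<Psi>). H \<subseteq> carrier (vertex_group \<Psi> v)))"
proof -
  interpret coxeter_in_pi1 \<Lambda> T W S
    by (intro coxeter_in_pi1.intro graph_of_groups_pi1.intro coxeter_in_pi1_axioms.intro assms)
  have vertex: "\<exists>u\<in>verts \<Gamma>. subconjugate \<pi> (generate \<pi> (fixing x)) (\<G> u)"
    if x: "x \<in> verts \<X>" for x
  proof -
    obtain v g where v: "v \<in> verts \<Gamma>" and g: "g \<in> carrier \<pi>" and eq: "x = (v, g <#\<^bsub>\<pi>\<^esub> \<G> v)"
      using x by (auto simp: verts_X)
    show ?thesis
      unfolding eq by (intro bexI[OF _ v] subconjugate_fixing vertex_subgroup v g)
  qed
  have edge: "\<exists>d\<in>arcs \<Gamma>. subconjugate \<pi> (generate \<pi> (fixing \<epsilon>)) (\<E> d)"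
    if \<epsilon>: "\<epsilon> \<in> arcs \<X>" for \<epsilon>
  proof -
    obtain e g where e: "e \<in> arcs \<Gamma>" and g: "g \<in> carrier \<pi>" and eq: "\<epsilon> = (e, g <#\<^bsub>\<pi>\<^esub> \<E> e)"
      using \<epsilon> by (auto simp: arcs_X)
    show ?thesis
      unfolding eq by (intro bexI[OF _ e] subconjugate_fixing edge_subgroup e g)
  qed
  show ?thesis
  proof (intro exI[of _ "visual_tree \<Lambda> T S"] conjI ballI allI impI)
    show "visual_decomposition \<W> S \<Psi>" by (rule visual_decomposition_visual_tree)
    show "\<exists>u\<in>verts \<Gamma>. subconjugate \<pi> (carrier (vertex_group \<Psi> x)) (\<G> u)"
      if "x \<in> verts (gog_graph \<Psi>)" for x
      using vertex[of x] that by simp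
    show "\<exists>d\<in>arcs \<Gamma>. subconjugate \<pi> (edge_group \<Psi> \<epsilon>) (\<E> d)"
      if "\<epsilon> \<in> arcs (gog_graph \<Psi>)" for \<epsilon>
      using edge[of \<epsilon>] that by simp
    show "\<exists>x\<in>verts (gog_graph \<Psi>). H \<subseteq> carrier (vertex_group \<Psi> x)"
      if "special_subgroup \<W> S H \<and> (\<exists>u\<in>verts \<Gamma>. subconjugate \<pi> H (\<G> u))" for H
      using special_subconjugate[of H] that by auto
  qed
qed

end
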